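(* Let $F:\mathcal{S}_n\to\mathbb{R}$ be of class $C^2$, quasiconcave, with $F(0)=0$, and uniformly elliptic in the sense that $\lambda|\xi|^2\leq F_{ij}(M)\xi_i\xi_j\leq\Lambda|\xi|^2$ for all $M\in\mathcal{S}_n$, $\xi\in\mathbb{R}^n$, where $0<\lambda\leq\Lambda$. Let $u\in C^2(B_1)$ satisfy $F(D^2u)=0$ in $B_1\subset\mathbb{R}^n$. Then \[ \|u\|_{C^{2,\alpha}(\overline{B}_{1/2})}\leq C, \] where $\alpha\in(0,1)$ depends only on $n,\lambda,\Lambda$, and $C$ depends on $n,\lambda,\Lambda$ and also on $\|u\|_{C^{1,1}(\overline{B}_{3/4})}$.
   Context: $\mathcal{S}_n$ denotes the space of real symmetric $n\times n$ matrices; $F_{ij}(M)=\partial F(M)/\partial m_{ij}$, with summation over repeated indices. $F$ is quasiconcave if all its superlevel sets $\{M\in\mathcal{S}_n: F(M)\geq a\}$, $a\in\mathbb{R}$, are convex, equivalently $F(\theta M_1+(1-\theta)M_2)\geq\min\{F(M_1),F(M_2)\}$ for all $M_1,M_2\in\mathcal{S}_n$, $\theta\in[0,1]$. $B_r$ is the ball of radius $r$ centered at $0$. *)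

theory Defs
  imports "HOL-Analysis.Analysis"
begin

definition sym_mats :: "(real^'n^'n) set" where
  "sym_mats = {M. transpose M = M}"

definition quasiconcave_sym :: "(real^'n^'n \<Rightarrow> real) \<Rightarrow> bool" where
  "quasiconcave_sym F \<longleftrightarrow>
     (\<forall>M1\<in>sym_mats. \<forall>M2\<in>sym_mats. \<forall>\<theta>::real. 0 \<le> \<theta> \<and> \<theta> \<le> 1 \<longrightarrow>
        F (\<theta> *\<^sub>R M1 + (1 - \<theta>) *\<^sub>R M2) \<ge> min (F M1) (F M2))"

definition outer :: "real^'n \<Rightarrow> real^'n \<Rightarrow> real^'n^'n" where
  "outer x y = (\<chi> i j. x $ i * y $ j)"

definition sup_norm :: "'a set \<Rightarrow> ('a \<Rightarrow> 'b::real_normed_vector) \<Rightarrow> ereal" where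
  "sup_norm S g = (SUP x\<in>S. ereal (norm (g x)))"

definition holder_semi :: "real \<Rightarrow> 'a::metric_space set \<Rightarrow> ('a \<Rightarrow> 'b::real_normed_vector) \<Rightarrow> ereal" where
  "holder_semi \<alpha> S g =
     (SUP p\<in>{(x, y). x \<in> S \<and> y \<in> S \<and> x \<noteq> y}.
        ereal (dist (g (fst p)) (g (snd p)) / (dist (fst p) (snd p)) powr \<alpha>))"

definition C11_norm :: "(real^'n) set \<Rightarrow> (real^'n \<Rightarrow> real) \<Rightarrow> (real^'n \<Rightarrow> real^'n) \<Rightarrow> ereal" where
  "C11_norm S u Du = sup_norm S u + sup_norm S Du + holder_semi 1 S Du"

definition C2alpha_norm :: "real \<Rightarrow> (real^'n) set \<Rightarrow> (real^'n \<Rightarrow> real) \<Rightarrow> (real^'n \<Rightarrow> real^'n)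
    \<Rightarrow> (real^'n \<Rightarrow> real^'n^'n) \<Rightarrow> ereal" where
  "C2alpha_norm \<alpha> S u Du H =
     sup_norm S u + sup_norm S Du + sup_norm S H + holder_semi \<alpha> S H"

end

theory Submission
  imports Defs
begin

text \<open>
  Since \<open>F\<close> vanishes at all values of the Hessian, quasiconcavity says that \<open>DF (H x) (H y - H x) \<ge> 0\<close>
  for all \<open>x\<close> and \<open>y\<close>. This has two consequences. First, second difference quotients of \<open>u\<close>,
  which are again \<open>C\<^sup>2\<close>, are subsolutions of linear elliptic equations, so \<open>S - u\<^sub>e\<^sub>e\<close> obeys the Krylov--Safonov growth lemma whenever \<open>S\<close> bounds
  \<open>u\<^sub>e\<^sub>e\<close> from above. Second, \<open>|H y - H x|\<close> is at most a constant times the largest value of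
  \<open>u\<^sub>e\<^sub>e(y) - u\<^sub>e\<^sub>e(x)\<close>, where \<open>e\<close> runs over a fixed finite set of directions. Hence no point of a ball can
  nearly maximise all these \<open>u\<^sub>e\<^sub>e\<close> at once, so by pigeonhole one of them lies well below its supremum
  on a fixed proportion of a smaller ball. By the growth lemma its supremum drops there, and the
  sum over \<open>e\<close> of the oscillations of \<open>u\<^sub>e\<^sub>e\<close> decays geometrically with the radius.
\<close>

subsection \<open>Elliptic functionals on matrices\<close>

text \<open>Since \<open>u\<close> is only C^2, the equation cannot be differentiated twice;
  difference quotients stand in for the missing fourth derivatives, and their step is sent to 0 only
  after the growth lemma has been applied. The functional \<open>DF (H x)\<close> comes with no
  control of its dependence on x, so each estimate must hold uniformly for elliptic functionals
  chosen separately at every point. The comparison of \<open>H y - H x\<close> with finitely many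
  quadratic forms rests on a balance: if \<open>L D \<ge> 0\<close> with \<open>L\<close> elliptic,
  negative eigenvalues of D must be compensated by positive ones of comparable size. The
  oscillations are summed over all directions because the direction that improves may change from
  one scale to the next; the other summands at least do not grow when the ball shrinks. The ratio 8
  between consecutive radii leaves room for the barrier and for translates of \<open>u\<close>, and
  the Hoelder exponent solves 8^(-alpha) = 1 - theta, where theta is the relative gain per
  step.\<close>

text \<open>On symmetric matrices these are the functionals tr(a M) with eigenvalues of a between
  \<open>lam\<close> and \<open>Lam\<close>. Keeping the functional instead of the matrix a lets
  \<open>DF (H x)\<close> be used as it is.\<close>

definition elliptic :: "real \<Rightarrow> real \<Rightarrow> (real^'n^'n \<Rightarrow> real) \<Rightarrow> bool" where
  "elliptic lam Lam L \<longleftrightarrow> linear L \<and>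
     (\<forall>\<xi>. lam * (norm \<xi>)\<^sup>2 \<le> L (outer \<xi> \<xi>) \<and> L (outer \<xi> \<xi>) \<le> Lam * (norm \<xi>)\<^sup>2)"

definition psd :: "real^'n^'n \<Rightarrow> bool" where
  "psd P \<longleftrightarrow> transpose P = P \<and> (\<forall>x. 0 \<le> x \<bullet> (P *v x))"

lemma inner_matrix_sym:
  fixes P :: "real^'n^'n"
  assumes "transpose P = P"
  shows "x \<bullet> (P *v y) = y \<bullet> (P *v x)"
  by (metis assms dot_lmul_matrix inner_commute matrix_vector_mul_lid transpose_matrix_vector)

lemma outer_mult_vec: "outer v w *v y = (w \<bullet> y) *\<^sub>R v" for v w y :: "real^'n"
  by (vector outer_def matrix_vector_mult_def inner_vec_def) (simp add: sum_distrib_left mult_ac)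

lemma inner_matrix_outer: "x \<bullet> (outer v w *v y) = (x \<bullet> v) * (w \<bullet> y)"
  for x v w y :: "real^'n"
  by (simp add: outer_mult_vec)

lemma trace_outer: "trace (outer v v) = (norm v)\<^sup>2" for v :: "real^'n"
  by (simp add: trace_def outer_def power2_norm_eq_inner inner_vec_def)

lemma trace_scaleR: "trace (c *\<^sub>R P) = c * trace P" for P :: "real^'n^'n"
  by (simp add: trace_def sum_distrib_left)

lemma transpose_outer: "transpose (outer v v) = outer v v" for v :: "real^'n"
  by (simp add: transpose_def outer_def vec_eq_iff mult.commute)

lemma transpose_lincomb:
  fixes P Q :: "real^'n^'n"
  shows "transpose (P + Q) = transpose P + transpose Q"
    "transpose (P - Q) = transpose P - transpose Q"
    "transpose (c *\<^sub>R P) = c *\<^sub>R transpose P"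
  by (simp_all add: transpose_def vec_eq_iff)

lemma subspace_sym_mats: "subspace (sym_mats :: (real^'n^'n) set)"
  by (auto simp: subspace_def sym_mats_def transpose_lincomb) (simp add: transpose_def vec_eq_iff)

lemma quadform_lincomb:
  fixes P Q :: "real^'n^'n"
  shows "x \<bullet> ((P + Q) *v y) = x \<bullet> (P *v y) + x \<bullet> (Q *v y)"
    "x \<bullet> ((P - Q) *v y) = x \<bullet> (P *v y) - x \<bullet> (Q *v y)"
    "x \<bullet> ((c *\<^sub>R P) *v y) = c * (x \<bullet> (P *v y))"
  by (simp_all add: matrix_vector_mult_add_rdistrib matrix_vector_mult_diff_rdistrib inner_add_right
      inner_diff_right scaleR_matrix_vector_assoc[symmetric])

lemma psd_Cauchy_Schwarz:
  fixes P :: "real^'n^'n"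
  assumes "psd P"
  shows "(x \<bullet> (P *v y))\<^sup>2 \<le> (x \<bullet> (P *v x)) * (y \<bullet> (P *v y))"
proof -
  define a b c where "a = y \<bullet> (P *v y)" and "b = x \<bullet> (P *v y)" and "c = x \<bullet> (P *v x)"
  have sym: "transpose P = P" and pos: "\<And>z. 0 \<le> z \<bullet> (P *v z)"
    using assms by (auto simp: psd_def)
  have q: "0 \<le> c + 2 * t * b + t\<^sup>2 * a" for t
  proof -
    have "(x + t *\<^sub>R y) \<bullet> (P *v (x + t *\<^sub>R y)) = c + 2 * t * b + t\<^sup>2 * a"
      using inner_matrix_sym[OF sym, of y x]
      by (simp add: a_def b_def c_def matrix_vector_right_distrib matrix_vector_mult_scaleR
          inner_add_left inner_add_right power2_eq_square algebra_simps)
    then show ?thesis using pos[of "x + t *\<^sub>R y"] by simp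
  qed
  have "a \<ge> 0" "c \<ge> 0" using pos by (auto simp: a_def c_def)
  show ?thesis
  proof (cases "a = 0")
    case True
    have "b = 0"
    proof (rule ccontr)
      assume "b \<noteq> 0"
      then show False using q[of "- (c + 1) / (2 * b)"] True by (simp add: field_simps)
    qed
    then show ?thesis using True by (simp add: a_def[symmetric] b_def[symmetric])
  next
    case False
    with \<open>a \<ge> 0\<close> have "a > 0" by simp
    have "0 \<le> c - b\<^sup>2 / a"
      using q[of "- b / a"] \<open>a > 0\<close> by (simp add: power2_eq_square field_simps)
    then show ?thesis using \<open>a > 0\<close>
      by (simp add: a_def[symmetric] b_def[symmetric] c_def[symmetric] field_simps)
  qed
qed

lemma matrix_entry: "P $ i $ j = axis i 1 \<bullet> (P *v axis j 1)" for P :: "real^'n^'n"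
  by (simp add: inner_axis' matrix_vector_mul_component inner_axis)

text \<open>A positive semidefinite matrix is a sum of rank-one matrices, for which the bounds are
  the definition of \<open>elliptic\<close>. The sum comes from symmetric elimination: each step
  splits off one rank-one matrix and clears one row and column, so the induction runs over the set
  \<open>I\<close> of indices whose rows may still be nonzero.\<close>

lemma psd_elliptic_bounds:
  fixes P :: "real^'n^'n"
  assumes L: "elliptic lam Lam L" and "psd P"
  shows "lam * trace P \<le> L P \<and> L P \<le> Lam * trace P"
proof -
  have lin: "linear L" and ell: "\<And>\<xi>. lam * (norm \<xi>)\<^sup>2 \<le> L (outer \<xi> \<xi>) \<and> L (outer \<xi> \<xi>) \<le> Lam * (norm \<xi>)\<^sup>2"
    using L by (auto simp: elliptic_def)
  have "\<forall>P. psd P \<longrightarrow> (\<forall>i j. i \<notin> I \<longrightarrow> P $ i $ j = 0) \<longrightarrow> lam * trace P \<le> L P \<and> L P \<le> Lam * trace P"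
    if "finite I" for I :: "'n set"
    using that
  proof (induction I)
    case empty
    have t0: "trace (0 :: real^'n^'n) = 0" by (simp add: trace_def)
    have "P = 0" if "\<forall>i j. P $ i $ j = 0" for P :: "real^'n^'n"
      using that by (simp add: vec_eq_iff)
    then show ?case using linear_0[OF lin] 
      by (metis (no_types) empty_iff mult_zero_right order_refl t0)
  next
    case (insert k I)
    show ?case
    proof (intro allI impI)
      fix P :: "real^'n^'n"
      assume P: "psd P" and supp: "\<forall>i j. i \<notin> insert k I \<longrightarrow> P $ i $ j = 0"
      \<comment> \<open>\<open>Q\<close> is what remains after eliminating with the pivot
        \<open>a\<close>. If the pivot is 0, Cauchy-Schwarz forces \<open>v = 0\<close>, so the
        convention \<open>1 / 0 = 0\<close> correctly gives \<open>Q = P\<close>.\<close>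
      define v a Q where "v = P *v axis k 1" and "a = P $ k $ k" and "Q = P - (1 / a) *\<^sub>R outer v v"
      have sym: "transpose P = P" using P by (simp add: psd_def)
      have Pij: "P $ i $ j = P $ j $ i" for i j
        using sym by (metis transpose_def vec_lambda_beta)
      have vi: "v $ i = P $ i $ k" for i
        by (simp add: v_def matrix_vector_mul_component inner_axis)
      have a: "a = axis k 1 \<bullet> (P *v axis k 1)" "a \<ge> 0"
        using P by (auto simp: a_def psd_def matrix_entry)
      have CS: "(x \<bullet> v)\<^sup>2 \<le> (x \<bullet> (P *v x)) * a" for x
        unfolding a v_def by (rule psd_Cauchy_Schwarz[OF P])
      have a0: "v = 0" if "a = 0"
        using CS[of v] that by simp
      have "psd Q"
        unfolding psd_def
      proof (intro conjI allI)
        show "transpose Q = Q" by (simp add: Q_def transpose_lincomb transpose_outer sym)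
        fix x
        have "x \<bullet> (Q *v x) = x \<bullet> (P *v x) - (x \<bullet> v)\<^sup>2 / a"
          by (simp add: Q_def quadform_lincomb inner_matrix_outer power2_eq_square inner_commute)
        moreover have "(x \<bullet> v)\<^sup>2 / a \<le> x \<bullet> (P *v x)"
          using CS[of x] a(2) P by (cases "a = 0") (auto simp: psd_def field_simps)
        ultimately show "0 \<le> x \<bullet> (Q *v x)" by simp
      qed
      moreover have "Q $ i $ j = 0" if "i \<notin> I" for i j
      proof (cases "i = k")
        case True
        have "v $ k = a" by (simp add: vi a_def)
        moreover have "P $ k $ j = 0" if "a = 0"
          using a0[OF that] vi[of j] Pij[of k j] by simp
        ultimately show ?thesis using True
          by (cases "a = 0") (auto simp: Q_def outer_def vi Pij[of k j])
      next
        case False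
        then show ?thesis using supp that by (simp add: Q_def outer_def vi)
      qed
      ultimately have IH: "lam * trace Q \<le> L Q" "L Q \<le> Lam * trace Q"
        using insert.IH by blast+
      have PQ: "P = Q + (1 / a) *\<^sub>R outer v v" by (simp add: Q_def)
      have LP: "L P = L Q + (1 / a) * L (outer v v)"
        by (subst PQ) (simp add: linear_add[OF lin] linear_scale[OF lin])
      have tP: "trace P = trace Q + (1 / a) * (norm v)\<^sup>2"
        by (subst PQ) (simp add: trace_add trace_scaleR trace_outer)
      have "(1 / a) * (lam * (norm v)\<^sup>2) \<le> (1 / a) * L (outer v v)"
        "(1 / a) * L (outer v v) \<le> (1 / a) * (Lam * (norm v)\<^sup>2)"
        using ell[of v] a(2) mult_left_mono[of _ _ "1 / a"] by (meson divide_nonneg_nonneg zero_le_one)+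
      then show "lam * trace P \<le> L P \<and> L P \<le> Lam * trace P"
        unfolding LP tP using IH by (simp add: algebra_simps)
    qed
  qed
  from this[of UNIV] assms(2) show ?thesis by simp
qed

lemma psd_entry_le_trace:
  fixes P :: "real^'n^'n"
  assumes "psd P"
  shows "\<bar>P $ i $ j\<bar> \<le> trace P"
proof -
  have diag: "0 \<le> P $ i $ i" for i
    using assms by (auto simp: psd_def matrix_entry)
  have le: "P $ i $ i \<le> trace P" for i
    unfolding trace_def by (rule member_le_sum) (auto simp: diag)
  have "(P $ i $ j)\<^sup>2 \<le> P $ i $ i * P $ j $ j"
    using psd_Cauchy_Schwarz[OF assms, of "axis i 1" "axis j 1"] by (simp add: matrix_entry)
  also have "\<dots> \<le> trace P * trace P"
    using diag[of i] diag[of j] le[of i] le[of j] by (intro mult_mono) auto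
  finally show ?thesis
    using order_trans[OF diag[of i] le[of i]] by (simp add: power2_eq_square[symmetric] abs_le_square_iff[symmetric])
qed

lemma norm_matrix_le:
  fixes P :: "real^'n^'n"
  assumes "\<And>i j. \<bar>P $ i $ j\<bar> \<le> b"
  shows "norm P \<le> real CARD('n)^2 * b"
proof -
  have "norm P \<le> (\<Sum>i\<in>UNIV. norm (P $ i))" 
    unfolding norm_vec_def by (rule L2_set_le_sum) auto
  also have "\<dots> \<le> (\<Sum>i\<in>(UNIV::'n set). \<Sum>j\<in>(UNIV::'n set). b)"
    by (intro sum_mono order_trans[OF norm_le_l1_cart]) (use assms in auto)
  finally show ?thesis by (simp add: power2_eq_square)
qed

lemma norm_matrix_vector_le: "norm (P *v y) \<le> norm P * norm y" for P :: "real^'n^'n"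
proof -
  have "norm (P *v y) = L2_set (\<lambda>i. P $ i \<bullet> y) UNIV"
    by (simp add: norm_vec_def matrix_vector_mul_component L2_set_def)
  also have "\<dots> = L2_set (\<lambda>i. \<bar>P $ i \<bullet> y\<bar>) UNIV" by (simp add: L2_set_def)
  also have "\<dots> \<le> L2_set (\<lambda>i. norm (P $ i) * norm y) UNIV"
    by (intro L2_set_mono) (auto simp: Cauchy_Schwarz_ineq2)
  also have "\<dots> = norm P * norm y"
    by (simp add: norm_vec_def[of P] L2_set_left_distrib[symmetric])
  finally show ?thesis .
qed

lemma abs_quadform_le: "\<bar>x \<bullet> (P *v y)\<bar> \<le> norm P * norm x * norm y" for P :: "real^'n^'n"
proof -
  have "norm x * norm (P *v y) \<le> norm x * (norm P * norm y)"
    by (intro mult_left_mono norm_matrix_vector_le) auto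
  then show ?thesis
    using Cauchy_Schwarz_ineq2[of x "P *v y"] by (simp add: mult_ac)
qed

lemma elliptic_mat1_le:
  fixes L :: "real^'n^'n \<Rightarrow> real"
  assumes "elliptic lam Lam L"
  shows "L (mat 1) \<le> Lam * CARD('n)"
proof -
  have "psd (mat 1 :: real^'n^'n)" by (simp add: psd_def)
  from psd_elliptic_bounds[OF assms this] show ?thesis by (simp add: trace_I)
qed

text \<open>Negative eigenvalues of \<open>D\<close> are limited by the positive ones:
  \<open>s *\<^sub>R mat 1 - D\<close> is positive semidefinite, \<open>L\<close> of it is at most
  \<open>s * L (mat 1)\<close> because \<open>L D \<ge> 0\<close>, and the lower ellipticity bound
  turns this into a bound for its trace, hence for all entries.\<close>

lemma elliptic_kernel_norm_le:
  fixes D :: "real^'n^'n"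
  assumes L: "elliptic lam Lam L" and "0 < lam" "0 \<le> s" and D: "transpose D = D" and LD: "L D \<ge> 0"
    and le: "\<And>x. norm x = 1 \<Longrightarrow> x \<bullet> (D *v x) \<le> s"
  shows "norm D \<le> real CARD('n)^2 * (Lam * CARD('n) / lam + 1) * s"
proof -
  define P where "P = s *\<^sub>R mat 1 - D"
  have lin: "linear L" using L by (simp add: elliptic_def)
  have "psd P" unfolding psd_def
  proof (intro conjI allI)
    show "transpose P = P" by (simp add: P_def transpose_lincomb D)
    fix x :: "real^'n"
    show "0 \<le> x \<bullet> (P *v x)"
    proof (cases "x = 0")
      case False
      define y where "y = (1 / norm x) *\<^sub>R x"
      have y: "norm y = 1" "x = norm x *\<^sub>R y" using False by (auto simp: y_def)
      have "x \<bullet> (P *v x) = (norm x)\<^sup>2 * (s - y \<bullet> (D *v y))"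
        apply (subst (1 2) y(2))
        using y(1) by (simp add: P_def quadform_lincomb matrix_vector_mult_scaleR power2_eq_square
            algebra_simps norm_eq_1)
      then show ?thesis using le[OF y(1)] by simp
    qed simp
  qed
  have "lam * trace P \<le> L P" using psd_elliptic_bounds[OF L \<open>psd P\<close>] by simp
  also have "\<dots> = s * L (mat 1) - L D" 
    by (simp add: P_def linear_diff[OF lin] linear_scale[OF lin])
  also have "\<dots> \<le> s * (Lam * CARD('n))"
    using elliptic_mat1_le[OF L] \<open>0 \<le> s\<close> LD mult_left_mono[of "L (mat 1)" "Lam * CARD('n)" s] by linarith
  finally have tr: "trace P \<le> Lam * CARD('n) / lam * s" using \<open>0 < lam\<close> by (simp add: field_simps)
  have "\<bar>D $ i $ j\<bar> \<le> (Lam * CARD('n) / lam + 1) * s" for i j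
  proof -
    have "D $ i $ j = s * (mat 1 :: real^'n^'n) $ i $ j - P $ i $ j" by (simp add: P_def)
    moreover have "\<bar>s * (mat 1 :: real^'n^'n) $ i $ j\<bar> \<le> s" using \<open>0 \<le> s\<close> by (simp add: mat_def)
    ultimately show ?thesis
      using psd_entry_le_trace[OF \<open>psd P\<close>, of i j] tr by (simp add: algebra_simps)
  qed
  from norm_matrix_le[OF this] show ?thesis by (simp add: mult_ac)
qed

text \<open>By compactness of the sphere, moving a unit vector to a net point changes the quadratic
  form by a small fraction of \<open>norm D\<close>, which the preceding bound absorbs.
  \<open>E\<close> and \<open>c\<close> depend only on the dimension, \<open>lam\<close> and
  \<open>Lam\<close>, so later pigeonholing over \<open>E\<close> has a fixed number of
  classes.\<close>

lemma elliptic_kernel_direction_net: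
  fixes lam Lam :: real
  assumes "0 < lam" "lam \<le> Lam"
  obtains E :: "(real^'n) set" and c :: real where "finite E" "E \<noteq> {}" "0 < c" "\<And>e. e \<in> E \<Longrightarrow> norm e = 1"
    "\<And>L D. elliptic lam Lam L \<Longrightarrow> transpose D = D \<Longrightarrow> L D \<ge> 0 \<Longrightarrow> \<exists>e\<in>E. c * norm D \<le> e \<bullet> (D *v e)"
proof -
  define A where "A = real CARD('n)^2 * (Lam * CARD('n) / lam + 1)"
  have A: "A > 0" unfolding A_def using assms by (intro mult_pos_pos add_nonneg_pos) auto
  \<comment> \<open>The 8 makes \<open>A * (1 / (2 * A) + 2 * \<delta>)\<close> equal to 3/4, which
    is below 1. The term \<open>2 * \<delta>\<close> pays for moving both arguments of the quadratic
    form.\<close>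
  define \<delta> where "\<delta> = 1 / (8 * A)"
  have \<delta>: "\<delta> > 0" using A by (simp add: \<delta>_def)
  have "\<exists>E. finite E \<and> E \<subseteq> sphere 0 1 \<and> sphere (0::real^'n) 1 \<subseteq> (\<Union>e\<in>E. ball e \<delta>)"
    by (rule seq_compact_imp_totally_bounded[rule_format]) (auto simp: \<delta> compact_eq_seq_compact_metric[symmetric])
  then obtain E where E: "finite E" "E \<subseteq> sphere 0 1" "sphere (0::real^'n) 1 \<subseteq> (\<Union>e\<in>E. ball e \<delta>)"
    by (elim exE conjE)
  have "axis undefined 1 \<in> sphere (0::real^'n) 1" by simp
  then have ne: "E \<noteq> {}" using E(3) by auto
  show thesis
  proof (rule that[of E "1 / (2 * A)"])
    fix L and D :: "real^'n^'n"
    assume L: "elliptic lam Lam L" and D: "transpose D = D" "L D \<ge> 0"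
    show "\<exists>e\<in>E. 1 / (2 * A) * norm D \<le> e \<bullet> (D *v e)"
    proof (rule ccontr)
      assume "\<not> ?thesis"
      then have lt: "e \<bullet> (D *v e) < 1 / (2 * A) * norm D" if "e \<in> E" for e
        using that by force
      \<comment> \<open>Positive parts are taken because the bound \<open>s\<close> in
        \<open>elliptic_kernel_norm_le\<close> has to be nonnegative.\<close>
      define m where "m = Max ((\<lambda>e. max 0 (e \<bullet> (D *v e))) ` E)"
      have m: "max 0 (e \<bullet> (D *v e)) \<le> m" if "e \<in> E" for e
        unfolding m_def by (rule Max_ge) (use that E(1) in auto)
      have "D \<noteq> 0" using lt ne by fastforce
      then have nD: "norm D > 0" by simp
      have mlt: "m < 1 / (2 * A) * norm D"
        unfolding m_def using E(1) ne lt nD A by (subst Max_less_iff) auto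
      have m0: "0 \<le> m" using m ne by fastforce
      have "x \<bullet> (D *v x) \<le> m + 2 * \<delta> * norm D" if "norm x = 1" for x
      proof -
        have "x \<in> (\<Union>e\<in>E. ball e \<delta>)" using that by (intro subsetD[OF E(3)]) simp
        then obtain e where e: "e \<in> E" "norm (x - e) < \<delta>" by (auto simp: dist_norm norm_minus_commute)
        then have e3: "norm e = 1" using E(2) by auto
        have "x \<bullet> (D *v x) = e \<bullet> (D *v e) + (x - e) \<bullet> (D *v x) + e \<bullet> (D *v (x - e))"
          by (simp add: matrix_vector_mult_diff_distrib inner_diff_left inner_diff_right)
        moreover have "(x - e) \<bullet> (D *v x) \<le> norm D * \<delta>"
          using abs_quadform_le[of "x - e" D x] that mult_left_mono[of "norm (x - e)" \<delta> "norm D"] e(2) by simp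
        moreover have "e \<bullet> (D *v (x - e)) \<le> norm D * \<delta>"
          using abs_quadform_le[of e D "x - e"] e3 mult_left_mono[of "norm (x - e)" \<delta> "norm D"] e(2) by simp
        ultimately show ?thesis using m[OF e(1)] by (simp add: algebra_simps)
      qed
      from elliptic_kernel_norm_le[OF L assms(1) _ D this] have "norm D \<le> A * (m + 2 * \<delta> * norm D)"
        using m0 \<delta> by (simp add: A_def)
      also have "\<dots> < A * (1 / (2 * A) * norm D + 2 * \<delta> * norm D)"
        using mlt A by simp
      also have "\<dots> = 3 / 4 * norm D" using A by (simp add: \<delta>_def field_simps)
      finally show False using nD by simp
    qed
  qed (use E ne A in auto)
qed

section \<open>Measure of images under pointwise Lipschitz maps\<close>

lemma measure_ball_scale:
  fixes x :: "'a::euclidean_space"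
  assumes "r \<ge> 0"
  shows "measure lebesgue (ball x r) = r ^ DIM('a) * measure lebesgue (ball (0::'a) 1)"
    and "measure lebesgue (cball x r) = r ^ DIM('a) * measure lebesgue (ball (0::'a) 1)"
  using content_ball_conv_unit_ball[OF assms, of x] content_cball_conv_ball[of x r] by simp_all

text \<open>A crude substitute for the area formula, by Vitali covering; it needs no determinants and no
  order on the index type.\<close>

lemma measure_pointwise_Lipschitz_image:
  fixes f :: "'a::euclidean_space \<Rightarrow> 'a"
  assumes S: "S \<in> lmeasurable" and T: "T \<in> lmeasurable" "T \<subseteq> f ` S" and "B > 0"
    and lip: "\<And>x. x \<in> S \<Longrightarrow> \<exists>d>0. \<forall>y\<in>ball x d. dist (f y) (f x) \<le> B * dist y x"
  shows "measure lebesgue T \<le> (5 * B) ^ DIM('a) * measure lebesgue S"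
proof (rule field_le_epsilon)
  fix \<epsilon> :: real assume "\<epsilon> > 0"
  define q where "q = (5 * B) ^ DIM('a)"
  have q: "q > 0" using \<open>B > 0\<close> by (simp add: q_def)
  define \<delta> where "\<delta> = \<epsilon> / q"
  have "\<delta> > 0" using \<open>\<epsilon> > 0\<close> q by (simp add: \<delta>_def)
  obtain U where U: "open U" "S \<subseteq> U" "U - S \<in> lmeasurable" "emeasure lebesgue (U - S) < ennreal \<delta>"
    using sets_lebesgue_outer_open[OF fmeasurableD[OF S] \<open>\<delta> > 0\<close>] by metis
  have "U = S \<union> (U - S)" using U(2) by blast
  then have Um: "U \<in> lmeasurable" using U(3) S by (metis fmeasurable.Un)
  have mU: "measure lebesgue U \<le> measure lebesgue S + \<delta>"
  proof -
    have "measure lebesgue (U - S) < \<delta>"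
      using U(3,4) by (metis emeasure_eq_measure2 ennreal_leI not_less)
    then show ?thesis using measurable_measure_Diff[OF Um fmeasurableD[OF S] U(2)] by simp
  qed
  \<comment> \<open>Vitali enlarges the selected disjoint balls five times, so the Lipschitz
    estimate is needed on radius \<open>5 * r\<close>, while only the small balls must lie in
    \<open>U\<close>. The bound by 1 supplies the bounded radii required for the covering.\<close>
  have "\<exists>r. 0 < r \<and> r \<le> 1 \<and> cball x r \<subseteq> U \<and> (\<forall>y\<in>cball x (5 * r). dist (f y) (f x) \<le> B * dist y x)"
    if x: "x \<in> S" for x
  proof -
    obtain d where d: "d > 0" "\<forall>y\<in>ball x d. dist (f y) (f x) \<le> B * dist y x" using lip[OF x] by blast
    obtain s where s: "s > 0" "cball x s \<subseteq> U" using x U open_contains_cball by blast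
    define r where "r = min 1 (min s (d / 6))"
    have "0 < r" "r \<le> 1" "r \<le> s" "5 * r < d" using d s by (auto simp: r_def)
    moreover have "cball x r \<subseteq> U" using \<open>r \<le> s\<close> s by (meson order_trans subset_cball)
    ultimately show ?thesis using d(2) by (intro exI[of _ r]) auto
  qed
  then have "\<forall>x\<in>S. \<exists>r. 0 < r \<and> r \<le> 1 \<and> cball x r \<subseteq> U \<and> (\<forall>y\<in>cball x (5 * r). dist (f y) (f x) \<le> B * dist y x)"
    by blast
  from bchoice[OF this] obtain r where r: "\<And>x. x \<in> S \<Longrightarrow> 0 < r x \<and> r x \<le> 1"
     "\<And>x. x \<in> S \<Longrightarrow> cball x (r x) \<subseteq> U"
     "\<And>x y. x \<in> S \<Longrightarrow> y \<in> cball x (5 * r x) \<Longrightarrow> dist (f y) (f x) \<le> B * dist y x" by blast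
  have cov: "S \<subseteq> (\<Union>x\<in>S. cball x (r x))" using r(1) by force
  obtain C where C: "countable C" "C \<subseteq> S"
     "pairwise (\<lambda>i j. disjnt (cball i (r i)) (cball j (r j))) C"
     "S \<subseteq> (\<Union>i\<in>C. cball i (5 * r i))"
    by (rule Vitali_covering_lemma_cballs[where a="\<lambda>x. x", OF cov r(1)])
  define G where "G = (\<lambda>x. cball (f x) (5 * B * r x))"
  have Tsub: "T \<subseteq> \<Union> (G ` C)"
  proof
    fix t assume "t \<in> T"
    then obtain s where s: "s \<in> S" "t = f s" using T by blast
    then obtain i where i: "i \<in> C" "s \<in> cball i (5 * r i)" using C by blast
    then have "dist (f s) (f i) \<le> B * dist s i" using r(3) C by blast
    also have "\<dots> \<le> B * (5 * r i)" using i \<open>B > 0\<close> by (intro mult_left_mono) (auto simp: dist_commute)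
    finally show "t \<in> \<Union> (G ` C)" using i s by (auto simp: G_def dist_commute mult_ac)
  qed
  have mG: "measure lebesgue (G x) = q * measure lebesgue (cball x (r x))" if "x \<in> S" for x
  proof -
    have "0 \<le> 5 * B * r x" "0 \<le> r x" using r(1)[OF that] \<open>B > 0\<close> by auto
    then show ?thesis
      using measure_ball_scale(2)[of "5 * B * r x" "f x"] measure_ball_scale(2)[of "r x" x]
      by (simp only: G_def q_def power_mult_distrib mult_ac)
  qed
  have fin: "measure lebesgue (\<Union> (G ` F)) \<le> q * measure lebesgue U" if F: "finite F" "F \<subseteq> C" for F
  proof -
    have "measure lebesgue (\<Union> (G ` F)) \<le> (\<Sum>x\<in>F. measure lebesgue (G x))"
      by (intro measure_UNION_le F) (auto simp: G_def)
    also have "\<dots> = q * (\<Sum>x\<in>F. measure lebesgue (cball x (r x)))"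
      using mG F C by (auto simp: sum_distrib_left intro!: sum.cong)
    also have "(\<Sum>x\<in>F. measure lebesgue (cball x (r x))) = measure lebesgue (\<Union>x\<in>F. cball x (r x))"
    proof (rule measure_finite_Union[symmetric])
      show "disjoint_family_on (\<lambda>x. cball x (r x)) F"
        using C(3) F unfolding disjoint_family_on_def pairwise_def disjnt_def by blast
    qed (use F emeasure_lborel_cball_finite in \<open>auto simp: less_top\<close>)
    also have "\<dots> \<le> measure lebesgue U"
    proof (intro measure_mono_fmeasurable Um)
      show "(\<Union>x\<in>F. cball x (r x)) \<subseteq> U" using F C(2) r(2) by blast
    qed (use F in \<open>auto intro!: sets.finite_UN\<close>)
    finally show ?thesis using q by (simp add: mult_left_mono)
  qed
  have Gm: "G x \<in> lmeasurable" for x by (simp add: G_def)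
  have "\<Union> (G ` C) \<in> lmeasurable" "measure lebesgue (\<Union> (G ` C)) \<le> q * measure lebesgue U"
    using fmeasurable_UN_bound[OF C(1), of G lebesgue "q * measure lebesgue U"] measure_UN_bound[OF C(1), of G lebesgue "q * measure lebesgue U"] Gm fin
    by auto
  then have "measure lebesgue T \<le> q * measure lebesgue U"
    using measure_mono_fmeasurable[OF Tsub] T by (meson fmeasurableD order_trans)
  also have "\<dots> \<le> q * (measure lebesgue S + \<delta>)" using mU q by simp
  also have "\<dots> = q * measure lebesgue S + \<epsilon>" using q by (simp add: \<delta>_def field_simps)
  finally show "measure lebesgue T \<le> (5 * B) ^ DIM('a) * measure lebesgue S + \<epsilon>" by (simp add: q_def)
qed

subsection \<open>Second differences\<close>

definition C2_on :: "(real^'n) set \<Rightarrow> (real^'n \<Rightarrow> real) \<Rightarrow> (real^'n \<Rightarrow> real^'n) \<Rightarrow> (real^'n \<Rightarrow> real^'n^'n) \<Rightarrow> bool"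
  where "C2_on S u Du H \<longleftrightarrow>
     (\<forall>x\<in>S. (u has_derivative (\<lambda>h. Du x \<bullet> h)) (at x)) \<and>
     (\<forall>x\<in>S. (Du has_derivative (\<lambda>h. H x *v h)) (at x)) \<and> continuous_on S H"

lemma C2_onD:
  assumes "C2_on S u Du H"
  shows "x \<in> S \<Longrightarrow> (u has_derivative (\<lambda>h. Du x \<bullet> h)) (at x)"
    "x \<in> S \<Longrightarrow> (Du has_derivative (\<lambda>h. H x *v h)) (at x)" "continuous_on S H"
  using assms by (auto simp: C2_on_def)

lemma C2_on_subset: "C2_on S u Du H \<Longrightarrow> T \<subseteq> S \<Longrightarrow> C2_on T u Du H"
  unfolding C2_on_def by (blast intro: continuous_on_subset)

lemma C2_on_imp_continuous_on: "C2_on S u Du H \<Longrightarrow> continuous_on S u"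
  by (meson C2_onD(1) continuous_at_imp_continuous_on has_derivative_continuous)

lemma C2_on_add:
  assumes "C2_on S u Du H" "C2_on S v Dv G"
  shows "C2_on S (\<lambda>x. u x + v x) (\<lambda>x. Du x + Dv x) (\<lambda>x. H x + G x)"
  using assms unfolding C2_on_def inner_add_left matrix_vector_mult_add_rdistrib
  by (blast intro: has_derivative_add continuous_on_add)

text \<open>The mean value theorem is applied twice: to the difference in direction \<open>b\<close>
  as a function of the step along \<open>a\<close>, then to the \<open>a\<close>-component of the
  gradient along \<open>b\<close>.\<close>

lemma mixed_second_difference:
  fixes u :: "real^'n \<Rightarrow> real"
  assumes u: "C2_on S u Du H" and "0 < h"
    and S: "\<And>s t. 0 \<le> s \<Longrightarrow> s \<le> h \<Longrightarrow> 0 \<le> t \<Longrightarrow> t \<le> h \<Longrightarrow> x + s *\<^sub>R a + t *\<^sub>R b \<in> S"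
  shows "\<exists>s t. 0 < s \<and> s < h \<and> 0 < t \<and> t < h \<and>
    u (x + h *\<^sub>R a + h *\<^sub>R b) - u (x + h *\<^sub>R a) - u (x + h *\<^sub>R b) + u x
      = h\<^sup>2 * (a \<bullet> (H (x + s *\<^sub>R a + t *\<^sub>R b) *v b))"
proof -
  define f where "f = (\<lambda>s. u (x + s *\<^sub>R a + h *\<^sub>R b) - u (x + s *\<^sub>R a))"
  have der: "((\<lambda>s. u (x + s *\<^sub>R a + t *\<^sub>R b)) has_real_derivative (Du (x + s *\<^sub>R a + t *\<^sub>R b) \<bullet> a)) (at s)"
    if "0 \<le> s" "s \<le> h" "0 \<le> t" "t \<le> h" for s t
  proof -
    have "((\<lambda>s. x + s *\<^sub>R a + t *\<^sub>R b) has_derivative (\<lambda>k. k *\<^sub>R a)) (at s)"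
      by (auto intro!: derivative_eq_intros)
    from has_derivative_compose[OF this, of u, OF C2_onD(1)[OF u S[OF that]]] show ?thesis
      by (simp add: has_field_derivative_def mult.commute[of _ "_ \<bullet> _"])
  qed
  have f: "(f has_real_derivative (Du (x + s *\<^sub>R a + h *\<^sub>R b) \<bullet> a - Du (x + s *\<^sub>R a) \<bullet> a)) (at s)"
    if "0 \<le> s" "s \<le> h" for s
    unfolding f_def using der[OF that, of h] der[OF that, of 0] \<open>0 < h\<close>
    by (auto intro!: derivative_intros)
  obtain s where s: "0 < s" "s < h" "f h - f 0 = h * (Du (x + s *\<^sub>R a + h *\<^sub>R b) \<bullet> a - Du (x + s *\<^sub>R a) \<bullet> a)"
    using MVT2[OF \<open>0 < h\<close> f] by auto
  have g: "((\<lambda>t. Du (x + s *\<^sub>R a + t *\<^sub>R b) \<bullet> a) has_real_derivative (a \<bullet> (H (x + s *\<^sub>R a + t *\<^sub>R b) *v b))) (at t)"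
    if "0 \<le> t" "t \<le> h" for t
  proof -
    have "x + s *\<^sub>R a + t *\<^sub>R b \<in> S" using s that by (intro S) auto
    note D = C2_onD(2)[OF u this]
    have "((\<lambda>t. x + s *\<^sub>R a + t *\<^sub>R b) has_derivative (\<lambda>k. k *\<^sub>R b)) (at t)"
      by (auto intro!: derivative_eq_intros)
    from has_derivative_compose[OF this, of Du, OF D]
    have "((\<lambda>t. Du (x + s *\<^sub>R a + t *\<^sub>R b)) has_derivative (\<lambda>k. H (x + s *\<^sub>R a + t *\<^sub>R b) *v (k *\<^sub>R b))) (at t)" .
    from has_derivative_inner_left[OF this, of a] show ?thesis
      by (simp add: has_field_derivative_def matrix_vector_mult_scaleR inner_commute mult.commute[of _ "_ \<bullet> _"])
  qed
  obtain t where t: "0 < t" "t < h" "Du (x + s *\<^sub>R a + h *\<^sub>R b) \<bullet> a - Du (x + s *\<^sub>R a) \<bullet> a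
      = h * (a \<bullet> (H (x + s *\<^sub>R a + t *\<^sub>R b) *v b))"
    using MVT2[OF \<open>0 < h\<close> g] by auto
  have "u (x + h *\<^sub>R a + h *\<^sub>R b) - u (x + h *\<^sub>R a) - u (x + h *\<^sub>R b) + u x = f h - f 0"
    by (simp add: f_def)
  also have "\<dots> = h\<^sup>2 * (a \<bullet> (H (x + s *\<^sub>R a + t *\<^sub>R b) *v b))"
    unfolding s(3) t(3) by (simp add: power2_eq_square)
  finally show ?thesis using s t by blast
qed

text \<open>This is the mixed difference with both directions equal to \<open>e\<close>, based at
  \<open>x - h *\<^sub>R e\<close>. Having an exact value for each fixed \<open>h\<close> carries
  pointwise bounds on the Hessian over to difference quotients.\<close>

lemma second_difference:
  fixes u :: "real^'n \<Rightarrow> real"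
  assumes u: "C2_on S u Du H" and "0 < h" and S: "\<And>t. \<bar>t\<bar> \<le> h \<Longrightarrow> x + t *\<^sub>R e \<in> S"
  shows "\<exists>t. \<bar>t\<bar> < h \<and> u (x + h *\<^sub>R e) + u (x - h *\<^sub>R e) - 2 * u x = h\<^sup>2 * (e \<bullet> (H (x + t *\<^sub>R e) *v e))"
proof -
  have eq: "x - h *\<^sub>R e + s *\<^sub>R e + t *\<^sub>R e = x + (s + t - h) *\<^sub>R e" for s t
    by (simp add: algebra_simps)
  have "x - h *\<^sub>R e + s *\<^sub>R e + t *\<^sub>R e \<in> S" if "0 \<le> s" "s \<le> h" "0 \<le> t" "t \<le> h" for s t
    unfolding eq using that by (intro S) auto
  from mixed_second_difference[OF u \<open>0 < h\<close> this]
  obtain s t where st: "0 < s" "s < h" "0 < t" "t < h"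
    "u (x - h *\<^sub>R e + h *\<^sub>R e + h *\<^sub>R e) - u (x - h *\<^sub>R e + h *\<^sub>R e) - u (x - h *\<^sub>R e + h *\<^sub>R e) + u (x - h *\<^sub>R e)
      = h\<^sup>2 * (e \<bullet> (H (x - h *\<^sub>R e + s *\<^sub>R e + t *\<^sub>R e) *v e))"
    by blast
  then show ?thesis unfolding eq by (intro exI[of _ "s + t - h"]) auto
qed

lemma continuous_on_quadform:
  "continuous_on S H \<Longrightarrow> continuous_on S (\<lambda>x. a \<bullet> (H x *v b))" for H :: "'a::topological_space \<Rightarrow> real^'n^'n"
  unfolding matrix_vector_mult_def inner_vec_def
  by (auto intro!: continuous_intros)

text \<open>The mixed difference does not depend on the order of the two directions, so two nearby
  values of the Hessian entries coincide, and continuity moves both to \<open>x\<close>.\<close>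

lemma C2_on_Hessian_sym:
  fixes u :: "real^'n \<Rightarrow> real"
  assumes u: "C2_on S u Du H" and "open S" "x \<in> S"
  shows "transpose (H x) = H x"
proof -
  have "a \<bullet> (H x *v b) = b \<bullet> (H x *v a)" for a b
  proof (rule ccontr)
    assume "a \<bullet> (H x *v b) \<noteq> b \<bullet> (H x *v a)"
    define \<epsilon> where "\<epsilon> = \<bar>a \<bullet> (H x *v b) - b \<bullet> (H x *v a)\<bar> / 2"
    have "\<epsilon> > 0" using \<open>_ \<noteq> _\<close> by (simp add: \<epsilon>_def)
    have cont: "isCont (\<lambda>y. a \<bullet> (H y *v b)) x" "isCont (\<lambda>y. b \<bullet> (H y *v a)) x"
      using continuous_on_quadform[OF C2_onD(3)[OF u]] assms(2,3) by (auto simp: continuous_on_eq_continuous_at)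
    obtain d where d: "d > 0" "\<And>y. dist y x < d \<Longrightarrow> dist (a \<bullet> (H y *v b)) (a \<bullet> (H x *v b)) < \<epsilon>"
        "\<And>y. dist y x < d \<Longrightarrow> dist (b \<bullet> (H y *v a)) (b \<bullet> (H x *v a)) < \<epsilon>" "ball x d \<subseteq> S"
    proof -
      obtain d1 d2 d3 where "d1 > 0" "\<And>y. dist y x < d1 \<Longrightarrow> dist (a \<bullet> (H y *v b)) (a \<bullet> (H x *v b)) < \<epsilon>"
        "d2 > 0" "\<And>y. dist y x < d2 \<Longrightarrow> dist (b \<bullet> (H y *v a)) (b \<bullet> (H x *v a)) < \<epsilon>"
        "d3 > 0" "ball x d3 \<subseteq> S"
        using cont \<open>\<epsilon> > 0\<close> assms(2,3) unfolding continuous_at_eps_delta open_contains_ball by metis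
      then show thesis by (intro that[of "min d1 (min d2 d3)"]) auto
    qed
    define h where "h = d / (2 * (norm a + norm b + 1))"
    have den: "norm a + norm b + 1 > 0" by (simp add: add_nonneg_pos)
    have h: "h > 0" using d den by (simp add: h_def)
    have near: "dist (x + s *\<^sub>R a + t *\<^sub>R b) x < d" if "0 \<le> s" "s \<le> h" "0 \<le> t" "t \<le> h" for s t
    proof -
      have "dist (x + s *\<^sub>R a + t *\<^sub>R b) x = norm (s *\<^sub>R a + t *\<^sub>R b)" by (simp add: dist_norm)
      also have "\<dots> \<le> s * norm a + t * norm b" using norm_triangle_ineq[of "s *\<^sub>R a" "t *\<^sub>R b"] that by simp
      also have "\<dots> \<le> h * norm a + h * norm b" using that by (intro add_mono mult_right_mono) auto
      also have "\<dots> < h * (2 * (norm a + norm b + 1))" using h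
        by (simp add: algebra_simps) (intro add_nonneg_pos mult_nonneg_nonneg, auto)
      also have "\<dots> = d" using den by (simp add: h_def)
      finally show ?thesis .
    qed
    have sub: "x + s *\<^sub>R a + t *\<^sub>R b \<in> S" if "0 \<le> s" "s \<le> h" "0 \<le> t" "t \<le> h" for s t
      using near[OF that] d(4) by (auto simp: dist_commute)
    have swap: "x + t *\<^sub>R b + s *\<^sub>R a = x + s *\<^sub>R a + t *\<^sub>R b" for s t by (simp add: algebra_simps)
    obtain s t where st: "0 < s" "s < h" "0 < t" "t < h"
      "u (x + h *\<^sub>R a + h *\<^sub>R b) - u (x + h *\<^sub>R a) - u (x + h *\<^sub>R b) + u x
        = h\<^sup>2 * (a \<bullet> (H (x + s *\<^sub>R a + t *\<^sub>R b) *v b))"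
      using mixed_second_difference[OF u h sub] by blast
    obtain s' t' where st': "0 < s'" "s' < h" "0 < t'" "t' < h"
      "u (x + h *\<^sub>R b + h *\<^sub>R a) - u (x + h *\<^sub>R b) - u (x + h *\<^sub>R a) + u x
        = h\<^sup>2 * (b \<bullet> (H (x + s' *\<^sub>R b + t' *\<^sub>R a) *v a))"
      using mixed_second_difference[OF u h, of x b a] sub unfolding swap by blast
    have "a \<bullet> (H (x + s *\<^sub>R a + t *\<^sub>R b) *v b) = b \<bullet> (H (x + s' *\<^sub>R b + t' *\<^sub>R a) *v a)"
      using st(5) st'(5) h unfolding swap by (auto simp: algebra_simps)
    moreover have "dist (a \<bullet> (H (x + s *\<^sub>R a + t *\<^sub>R b) *v b)) (a \<bullet> (H x *v b)) < \<epsilon>"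
      using st by (intro d near) auto
    moreover have "dist (b \<bullet> (H (x + s' *\<^sub>R b + t' *\<^sub>R a) *v a)) (b \<bullet> (H x *v a)) < \<epsilon>"
      unfolding swap using st' by (intro d near) auto
    ultimately show False unfolding \<epsilon>_def dist_real_def by argo
  qed
  then show ?thesis by (simp add: vec_eq_iff transpose_def matrix_entry)
qed

lemma second_difference_limit:
  fixes u :: "real^'n \<Rightarrow> real"
  assumes u: "C2_on S u Du H" and "open S" "x \<in> S"
  shows "((\<lambda>h. (u (x + h *\<^sub>R e) + u (x - h *\<^sub>R e) - 2 * u x) / h\<^sup>2) \<longlongrightarrow> e \<bullet> (H x *v e)) (at_right 0)"
proof (rule tendstoI)
  fix \<epsilon> :: real assume "\<epsilon> > 0"
  have "isCont (\<lambda>y. e \<bullet> (H y *v e)) x"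
    using continuous_on_quadform[OF C2_onD(3)[OF u]] assms(2,3) by (auto simp: continuous_on_eq_continuous_at)
  then obtain d1 d2 where d: "d1 > 0" "\<And>y. dist y x < d1 \<Longrightarrow> dist (e \<bullet> (H y *v e)) (e \<bullet> (H x *v e)) < \<epsilon>"
    "d2 > 0" "ball x d2 \<subseteq> S"
    using \<open>\<epsilon> > 0\<close> assms(2,3) unfolding continuous_at_eps_delta open_contains_ball by metis
  define d where "d = min d1 d2 / (norm e + 1)"
  have den: "norm e + 1 > 0" by (simp add: add_nonneg_pos)
  have dpos: "d > 0" using d den by (simp add: d_def)
  have near: "dist (x + t *\<^sub>R e) x < min d1 d2" if "\<bar>t\<bar> \<le> h" "h < d" for t h
  proof -
    have "dist (x + t *\<^sub>R e) x \<le> h * norm e" using that by (simp add: dist_norm mult_right_mono)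
    also have "\<dots> \<le> h * (norm e + 1)" using that by (intro mult_left_mono) auto
    also have "\<dots> < d * (norm e + 1)" using that den by simp
    finally show ?thesis using den by (simp add: d_def)
  qed
  show "\<forall>\<^sub>F h in at_right 0. dist ((u (x + h *\<^sub>R e) + u (x - h *\<^sub>R e) - 2 * u x) / h\<^sup>2) (e \<bullet> (H x *v e)) < \<epsilon>"
    unfolding eventually_at_right[OF zero_less_one]
  proof (intro exI[of _ d] conjI allI impI)
    fix h assume h: "0 < h" "h < d"
    have "x + t *\<^sub>R e \<in> S" if "\<bar>t\<bar> \<le> h" for t
      using near[OF that h(2)] d(4) by (auto simp: dist_commute)
    from second_difference[OF u h(1) this] obtain t where
      t: "\<bar>t\<bar> < h" "u (x + h *\<^sub>R e) + u (x - h *\<^sub>R e) - 2 * u x = h\<^sup>2 * (e \<bullet> (H (x + t *\<^sub>R e) *v e))" by blast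
    then show "dist ((u (x + h *\<^sub>R e) + u (x - h *\<^sub>R e) - 2 * u x) / h\<^sup>2) (e \<bullet> (H x *v e)) < \<epsilon>"
      using d(2)[of "x + t *\<^sub>R e"] near[of t h] h by simp
  qed (rule dpos)
qed

text \<open>Describes a point where an affine function of slope \<open>p\<close> touches
  \<open>v\<close> from below. Affine terms cancel in second differences, so those of
  \<open>v\<close> at \<open>y\<close> are nonnegative.\<close>

lemma local_min_gradient_Hessian:
  fixes v :: "real^'n \<Rightarrow> real"
  assumes v: "C2_on S v Dv H" and "open S" "y \<in> S"
    and min: "\<And>x. x \<in> S \<Longrightarrow> v y - p \<bullet> y \<le> v x - p \<bullet> x"
  shows "Dv y = p" and "psd (H y)"
proof -
  have "((\<lambda>x. v x - p \<bullet> x) has_derivative (\<lambda>h. Dv y \<bullet> h - p \<bullet> h)) (at y)"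
    by (intro derivative_intros C2_onD(1)[OF v \<open>y \<in> S\<close>])
  then have "(\<lambda>h. Dv y \<bullet> h - p \<bullet> h) = (\<lambda>h. 0)"
    using differential_zero_maxmin[of y S] assms by blast
  then have "(Dv y - p) \<bullet> (Dv y - p) = 0" by (metis inner_diff_left)
  then show "Dv y = p" by simp
  show "psd (H y)" unfolding psd_def
  proof (intro conjI allI)
    show "transpose (H y) = H y" using C2_on_Hessian_sym[OF v] assms by blast
    fix e
    have "\<forall>\<^sub>F h in at_right 0. y + h *\<^sub>R e \<in> S \<and> y - h *\<^sub>R e \<in> S"
    proof (rule eventually_conj)
      have "((\<lambda>h. y + h *\<^sub>R e) \<longlongrightarrow> y + 0 *\<^sub>R e) (at_right 0)" "((\<lambda>h. y - h *\<^sub>R e) \<longlongrightarrow> y - 0 *\<^sub>R e) (at_right 0)"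
        by (intro tendsto_intros)+
      then show "\<forall>\<^sub>F h in at_right 0. y + h *\<^sub>R e \<in> S" "\<forall>\<^sub>F h in at_right 0. y - h *\<^sub>R e \<in> S"
        using topological_tendstoD[OF _ \<open>open S\<close>] \<open>y \<in> S\<close> by force+
    qed
    then have "\<forall>\<^sub>F h in at_right 0. 0 \<le> (v (y + h *\<^sub>R e) + v (y - h *\<^sub>R e) - 2 * v y) / h\<^sup>2"
    proof eventually_elim
      case (elim h)
      then show ?case using min[of "y + h *\<^sub>R e"] min[of "y - h *\<^sub>R e"]
        by (auto simp: inner_add_right inner_diff_right)
    qed
    then show "0 \<le> e \<bullet> (H y *v e)"
      by (intro tendsto_lowerbound[OF second_difference_limit[OF v \<open>open S\<close> \<open>y \<in> S\<close>]]) auto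
  qed
qed

subsection \<open>The Krylov--Safonov growth lemma\<close>

text \<open>For symmetric values of \<open>H\<close> this says that the minimal Pucci operator is at
  most 0. The functional may vary with the point without any regularity, as it must for
  \<open>DF (H x)\<close>.\<close>

definition supersolution_on :: "real \<Rightarrow> real \<Rightarrow> (real^'n) set \<Rightarrow> (real^'n \<Rightarrow> real^'n^'n) \<Rightarrow> bool" where
  "supersolution_on lam Lam S H \<longleftrightarrow> (\<forall>x\<in>S. \<exists>L. elliptic lam Lam L \<and> L (H x) \<le> 0)"

lemma C2_on_gaussian:
  fixes x0 :: "real^'n" and a b k :: real
  defines "g \<equiv> \<lambda>x. exp (- k * ((x - x0) \<bullet> (x - x0)))"
  shows "C2_on S (\<lambda>x. a - b * g x) (\<lambda>x. (2 * k * b * g x) *\<^sub>R (x - x0))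
    (\<lambda>x. (b * g x) *\<^sub>R ((2 * k) *\<^sub>R mat 1 - (4 * k\<^sup>2) *\<^sub>R outer (x - x0) (x - x0)))"
proof -
  have g: "(g has_derivative (\<lambda>h. - 2 * k * g x * ((x - x0) \<bullet> h))) (at x)" for x
    unfolding g_def by (auto intro!: derivative_eq_intros simp: algebra_simps inner_commute fun_eq_iff)
  have [continuous_intros]: "continuous_on S g" for S
    unfolding g_def by (intro continuous_intros)
  show ?thesis unfolding C2_on_def
  proof (intro conjI ballI)
    fix x
    show "((\<lambda>x. a - b * g x) has_derivative (\<lambda>h. (2 * k * b * g x) *\<^sub>R (x - x0) \<bullet> h)) (at x)"
      by (rule derivative_eq_intros g refl)+ (simp add: algebra_simps)
    show "((\<lambda>x. (2 * k * b * g x) *\<^sub>R (x - x0)) has_derivative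
        (\<lambda>h. (b * g x) *\<^sub>R ((2 * k) *\<^sub>R mat 1 - (4 * k\<^sup>2) *\<^sub>R outer (x - x0) (x - x0)) *v h)) (at x)"
      by (rule derivative_eq_intros g refl)+
         (simp add: fun_eq_iff scaleR_matrix_vector_assoc[symmetric] matrix_vector_mult_diff_rdistrib
           outer_mult_vec power2_eq_square algebra_simps)
    show "continuous_on S (\<lambda>x. (b * g x) *\<^sub>R ((2 * k) *\<^sub>R mat 1 - (4 * k\<^sup>2) *\<^sub>R outer (x - x0) (x - x0)))"
      unfolding outer_def by (intro continuous_intros continuous_on_vec_lambda) 
  qed
qed

text \<open>The Aleksandrov--Bakelman--Pucci argument. Adding a Gaussian barrier to \<open>w\<close> moves all points
  where an affine function of small slope touches from below into the ball of radius \<open>r\<close>, while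
  the gradients at such points fill a ball.\<close>

lemma supersolution_point_to_measure:
  fixes lam Lam :: real
  assumes "0 < lam" "lam \<le> Lam"
  obtains M \<mu> :: real where "M > 1" "0 < \<mu>" "\<mu> < 1"
    "\<And>w Dw H (x0::real^'n) r z. 0 < r \<Longrightarrow> C2_on (ball x0 (5 * r)) w Dw H \<Longrightarrow>
       supersolution_on lam Lam (ball x0 (5 * r)) H \<Longrightarrow> (\<And>x. x \<in> ball x0 (5 * r) \<Longrightarrow> 0 \<le> w x) \<Longrightarrow>
       z \<in> cball x0 (3 * r) \<Longrightarrow> w z \<le> 1 \<Longrightarrow>
       \<mu> * measure lebesgue (ball x0 r) \<le> measure lebesgue {x \<in> cball x0 r. w x \<le> M}"
proof -
  define n where "n = real CARD('n)"
  have n: "n \<ge> 1" by (simp add: n_def Suc_leI)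
  \<comment> \<open>With \<open>k = \<gamma> / r\<^sup>2\<close> this makes
    \<open>2 * k * (n * Lam) - 4 * k\<^sup>2 * (lam * q)\<close> negative as soon as
    \<open>q \<ge> r\<^sup>2\<close>: the barrier is a strict supersolution outside the ball of
    radius \<open>r\<close>.\<close>
  define \<gamma> where "\<gamma> = n * Lam / lam"
  have \<gamma>: "\<gamma> > 0" "lam * \<gamma> = n * Lam" using assms n by (auto simp: \<gamma>_def)
  \<comment> \<open>Normalises the barrier: it vanishes at distance \<open>4 * r\<close> and is at
    most -2 up to distance \<open>3 * r\<close>, where \<open>z\<close> lies; 9 and 16 are the
    squares of 3 and 4. As the barrier exceeds \<open>- \<beta>\<close>, negativity of the sum
    bounds \<open>w\<close> by \<open>\<beta>\<close>, which therefore serves as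
    \<open>M\<close>.\<close>
  define \<beta> where "\<beta> = 2 / (exp (- 9 * \<gamma>) - exp (- 16 * \<gamma>))"
  have \<beta>den: "0 < exp (- 9 * \<gamma>) - exp (- 16 * \<gamma>)" using \<gamma> by simp
  have "exp (- 9 * \<gamma>) < 1" "0 < exp (- 16 * \<gamma>)" using \<gamma> by simp_all
  then have \<beta>den1: "exp (- 9 * \<gamma>) - exp (- 16 * \<gamma>) < 1" by linarith
  have \<beta>: "\<beta> > 1" using \<beta>den \<beta>den1 unfolding \<beta>_def by (subst less_divide_eq_1_pos) linarith+
  \<comment> \<open>At a touching point the trace of the Hessian is at most
    \<open>2 * \<beta> * \<gamma>\<^sup>2 / r\<^sup>2\<close>; the factor \<open>n\<^sup>2\<close>
    passes from entries to the norm.\<close>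
  define b where "b = n\<^sup>2 * (2 * \<beta> * \<gamma>\<^sup>2)"
  have b: "b \<ge> 0" using \<beta> by (simp add: b_def)
  define \<mu> where "\<mu> = (1 / (40 * (b + 1))) ^ CARD('n)"
  have "1 / (40 * (b + 1)) < 1" using b by simp
  then have \<mu>: "0 < \<mu>" "\<mu> < 1"
    using b unfolding \<mu>_def by (auto intro!: power_less_one_iff[THEN iffD2])
  show thesis
  proof (rule that[OF \<beta> \<mu>])
    fix w Dw H and x0 z :: "real^'n" and r :: real
    assume r: "0 < r" and w: "C2_on (ball x0 (5 * r)) w Dw H"
      and super: "supersolution_on lam Lam (ball x0 (5 * r)) H"
      and nonneg: "\<And>x. x \<in> ball x0 (5 * r) \<Longrightarrow> 0 \<le> w x"
      and z: "z \<in> cball x0 (3 * r)" "w z \<le> 1"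
    define k where "k = \<gamma> / r\<^sup>2"
    have k: "k > 0" "k * r\<^sup>2 = \<gamma>" using \<gamma> r by (auto simp: k_def)
    define g where "g = (\<lambda>x. exp (- k * ((x - x0) \<bullet> (x - x0))))"
    define G where "G = (\<lambda>x. (\<beta> * g x) *\<^sub>R ((2 * k) *\<^sub>R mat 1 - (4 * k\<^sup>2) *\<^sub>R outer (x - x0) (x - x0)) :: real^'n^'n)"
    define v where "v = (\<lambda>x. w x + (\<beta> * exp (- 16 * \<gamma>) - \<beta> * g x))"
    define Dv where "Dv = (\<lambda>x. Dw x + (2 * k * \<beta> * g x) *\<^sub>R (x - x0))"
    define Hv where "Hv = (\<lambda>x. H x + G x)"
    have v: "C2_on (ball x0 (5 * r)) v Dv Hv"
      unfolding v_def Dv_def Hv_def G_def g_def by (intro C2_on_add w C2_on_gaussian)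
    have g_le: "g x \<le> exp (- (m\<^sup>2) * \<gamma>)" if "m * r \<le> dist x x0" "0 \<le> m" for x m
    proof -
      have "(m * r)\<^sup>2 \<le> (dist x x0)\<^sup>2" using that r by (intro power_mono) auto
      then have "k * (m * r)\<^sup>2 \<le> k * ((x - x0) \<bullet> (x - x0))"
        using k by (simp add: dist_norm power2_norm_eq_inner)
      moreover have "k * (m * r)\<^sup>2 = m\<^sup>2 * \<gamma>" by (simp add: k(2)[symmetric] power_mult_distrib)
      ultimately show ?thesis by (simp add: g_def)
    qed
    have g_ge: "exp (- 9 * \<gamma>) \<le> g x" if "dist x x0 \<le> 3 * r" for x
    proof -
      have "(dist x x0)\<^sup>2 \<le> (3 * r)\<^sup>2" using that by (intro power_mono) auto
      then have "k * ((x - x0) \<bullet> (x - x0)) \<le> k * (3 * r)\<^sup>2"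
        using k by (simp add: dist_norm power2_norm_eq_inner)
      moreover have "k * (3 * r)\<^sup>2 = 9 * \<gamma>" by (simp add: k(2)[symmetric] power_mult_distrib)
      ultimately show ?thesis by (simp add: g_def)
    qed
    have g01: "0 < g x" "g x \<le> 1" for x using g_le[of 0 x] by (auto simp: g_def)
    have vz: "v z \<le> - 1"
    proof -
      have "\<beta> * (exp (- 9 * \<gamma>) - exp (- 16 * \<gamma>)) = 2"
        using less_imp_neq[OF \<beta>den] unfolding \<beta>_def by (subst nonzero_eq_divide_eq[symmetric]) auto
      moreover have "\<beta> * exp (- 9 * \<gamma>) \<le> \<beta> * g z" using g_ge[of z] z \<beta> by (simp add: dist_commute)
      ultimately show ?thesis using z(2) unfolding v_def by (simp add: algebra_simps)
    qed
    have v_sphere: "0 \<le> v x" if "dist x x0 = 4 * r" for x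
    proof -
      have "\<beta> * g x \<le> \<beta> * exp (- 16 * \<gamma>)" using g_le[of 4 x] that \<beta> by simp
      then show ?thesis using nonneg[of x] that r by (simp add: v_def dist_commute)
    qed
    define S where "S = {x \<in> cball x0 r. w x \<le> \<beta> \<and> norm (Hv x) \<le> b / r\<^sup>2}"
    \<comment> \<open>For such slopes the linear term is at most 4/8 on the ball of radius
      \<open>4 * r\<close> and 3/8 at \<open>z\<close>. With \<open>v z \<le> - 1\<close> the
      minimum has \<open>v y < 0\<close>, so it cannot lie on the sphere, where
      \<open>v \<ge> 0\<close>.\<close>
    have touch: "p \<in> Dv ` S" if p: "norm p \<le> 1 / (8 * r)" for p
    proof -
      have pr: "\<bar>p \<bullet> (x - x0)\<bar> \<le> m / 8" if "dist x x0 \<le> m * r" for x m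
      proof -
        have "\<bar>p \<bullet> (x - x0)\<bar> \<le> norm p * dist x x0" unfolding dist_norm by (rule Cauchy_Schwarz_ineq2)
        also have "\<dots> \<le> 1 / (8 * r) * (m * r)" using p that r by (intro mult_mono) auto
        also have "\<dots> = m / 8" using r by simp
        finally show ?thesis .
      qed
      have "continuous_on (cball x0 (4 * r)) v"
        using C2_on_imp_continuous_on[OF v] by (rule continuous_on_subset) (use r in auto)
      then have "continuous_on (cball x0 (4 * r)) (\<lambda>x. v x - p \<bullet> (x - x0))" by (intro continuous_intros)
      then obtain y where y: "y \<in> cball x0 (4 * r)"
          "\<And>x. x \<in> cball x0 (4 * r) \<Longrightarrow> v y - p \<bullet> (y - x0) \<le> v x - p \<bullet> (x - x0)"
        using continuous_attains_inf[of "cball x0 (4 * r)"] r by fastforce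
      have "v y - p \<bullet> (y - x0) \<le> v z - p \<bullet> (z - x0)" using z r by (intro y) auto
      moreover have "\<bar>p \<bullet> (z - x0)\<bar> \<le> 3 / 8" using z by (intro pr) (auto simp: dist_commute)
      moreover have py: "\<bar>p \<bullet> (y - x0)\<bar> \<le> 4 / 8" using y by (intro pr) (auto simp: dist_commute)
      ultimately have vy: "v y < 0" using vz by argo
      then have "dist y x0 \<noteq> 4 * r" using v_sphere[of y] by auto
      then have yin: "y \<in> ball x0 (4 * r)" using y(1) by (auto simp: dist_commute)
      have v4: "C2_on (ball x0 (4 * r)) v Dv Hv" by (rule C2_on_subset[OF v]) (use r in auto)
      have "v y - p \<bullet> y \<le> v x - p \<bullet> x" if "x \<in> ball x0 (4 * r)" for x
        using y(2)[of x] that by (simp add: inner_diff_right)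
      note min = local_min_gradient_Hessian[OF v4 open_ball yin this]
      obtain L where L: "elliptic lam Lam L" "L (H y) \<le> 0"
        using super yin r unfolding supersolution_on_def by fastforce
      have lin: "linear L" using L by (simp add: elliptic_def)
      define q where "q = (y - x0) \<bullet> (y - x0)"
      have q0: "0 \<le> q" by (simp add: q_def)
      have Lo: "lam * q \<le> L (outer (y - x0) (y - x0))"
        using L(1) unfolding elliptic_def q_def power2_norm_eq_inner by blast
      have LI: "L (mat 1) \<le> n * Lam" using elliptic_mat1_le[OF L(1)] by (simp add: n_def mult.commute)
      have "L (Hv y) = L (H y) + \<beta> * g y * (2 * k * L (mat 1) - 4 * k\<^sup>2 * L (outer (y - x0) (y - x0)))"
        unfolding Hv_def G_def linear_add[OF lin] linear_scale[OF lin] linear_diff[OF lin] by simp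
      also have "\<dots> \<le> \<beta> * g y * (2 * k * (n * Lam) - 4 * k\<^sup>2 * (lam * q))"
      proof -
        have "2 * k * L (mat 1) - 4 * k\<^sup>2 * L (outer (y - x0) (y - x0)) \<le> 2 * k * (n * Lam) - 4 * k\<^sup>2 * (lam * q)"
          using LI Lo k by (intro diff_mono mult_left_mono) auto
        moreover have "0 \<le> \<beta> * g y" using \<beta> g01(1)[of y] by simp
        ultimately have "\<beta> * g y * (2 * k * L (mat 1) - 4 * k\<^sup>2 * L (outer (y - x0) (y - x0)))
            \<le> \<beta> * g y * (2 * k * (n * Lam) - 4 * k\<^sup>2 * (lam * q))" by (rule mult_left_mono)
        then show ?thesis using L(2) by linarith
      qed
      finally have LHv: "L (Hv y) \<le> \<beta> * g y * (2 * k * (n * Lam) - 4 * k\<^sup>2 * (lam * q))" .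
      have tr0: "0 \<le> trace (Hv y)"
        using psd_entry_le_trace[OF min(2), of undefined undefined] by linarith
      have ltr: "lam * trace (Hv y) \<le> L (Hv y)" using psd_elliptic_bounds[OF L(1) min(2)] by blast
      \<comment> \<open>At a touching point the Hessian of \<open>v\<close> is positive
        semidefinite, so \<open>L\<close> of it is nonnegative; outside the ball of radius
        \<open>r\<close> the barrier would make it negative.\<close>
      have "dist y x0 < r"
      proof (rule ccontr)
        assume "\<not> dist y x0 < r"
        then have "r\<^sup>2 \<le> (dist y x0)\<^sup>2" using r by (intro power_mono) auto
        then have "r\<^sup>2 \<le> q" by (simp add: q_def dist_norm power2_norm_eq_inner)
        then have "k * lam * (k * r\<^sup>2) \<le> k * lam * (k * q)" using k assms by (intro mult_left_mono) auto
        then have "k * (n * Lam) \<le> k\<^sup>2 * (lam * q)"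
          unfolding k(2) mult.assoc \<gamma>(2) by (simp add: power2_eq_square mult_ac)
        moreover have "0 < k * (n * Lam)" using k n assms by auto
        ultimately have "2 * k * (n * Lam) - 4 * k\<^sup>2 * (lam * q) < 0" by linarith
        then have "\<beta> * g y * (2 * k * (n * Lam) - 4 * k\<^sup>2 * (lam * q)) < 0"
          using \<beta> g01[of y] by (intro mult_pos_neg) auto
        moreover have "0 \<le> lam * trace (Hv y)" using tr0 assms by simp
        ultimately show False using LHv ltr by linarith
      qed
      moreover have "w y \<le> \<beta>"
      proof -
        have "\<beta> * g y \<le> \<beta> * 1" using \<beta> g01[of y] by (intro mult_left_mono) auto
        moreover have "0 < \<beta> * exp (- 16 * \<gamma>)" using \<beta> by simp
        ultimately show ?thesis using vy unfolding v_def by linarith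
      qed
      moreover have "norm (Hv y) \<le> b / r\<^sup>2"
      proof -
        have "L (Hv y) \<le> \<beta> * g y * (2 * k * (n * Lam))"
          by (rule order_trans[OF LHv]) (use \<beta> g01[of y] q0 assms in \<open>auto intro!: mult_left_mono\<close>)
        also have "\<dots> \<le> \<beta> * 1 * (2 * k * (n * Lam))"
          using \<beta> g01[of y] k n assms by (intro mult_mono) auto
        also have "\<dots> = lam * (2 * \<beta> * \<gamma>\<^sup>2 / r\<^sup>2)"
          by (simp add: \<gamma>(2)[symmetric] k_def power2_eq_square)
        finally have "lam * trace (Hv y) \<le> lam * (2 * \<beta> * \<gamma>\<^sup>2 / r\<^sup>2)" using ltr by linarith
        then have "trace (Hv y) \<le> 2 * \<beta> * \<gamma>\<^sup>2 / r\<^sup>2"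
          unfolding mult_le_cancel_left_pos[OF assms(1)] .
        then have "\<bar>Hv y $ i $ j\<bar> \<le> 2 * \<beta> * \<gamma>\<^sup>2 / r\<^sup>2" for i j
          using psd_entry_le_trace[OF min(2), of i j] by linarith
        from norm_matrix_le[OF this] show ?thesis by (simp add: b_def n_def)
      qed
      ultimately have "y \<in> S" by (auto simp: S_def dist_commute)
      then show ?thesis using min(1) by blast
    qed
    have wc: "continuous_on (cball x0 r) w" "continuous_on (cball x0 r) Hv"
      by (rule continuous_on_subset[OF C2_on_imp_continuous_on[OF w]], use r in auto)
         (rule continuous_on_subset[OF C2_onD(3)[OF v]], use r in auto)
    have "compact S"
    proof -
      have "S = (cball x0 r \<inter> w -` {..\<beta>}) \<inter> (cball x0 r \<inter> (\<lambda>x. norm (Hv x)) -` {..b / r\<^sup>2})"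
        by (auto simp: S_def)
      moreover have "closed (cball x0 r \<inter> w -` {..\<beta>})"
        by (intro continuous_closed_preimage wc) auto
      moreover have "closed (cball x0 r \<inter> (\<lambda>x. norm (Hv x)) -` {..b / r\<^sup>2})"
        by (intro continuous_closed_preimage continuous_intros wc) auto
      moreover have "S \<subseteq> cball x0 r" by (auto simp: S_def)
      ultimately show ?thesis by (metis bounded_cball bounded_subset closed_Int compact_eq_bounded_closed)
    qed
    then have Sm: "S \<in> lmeasurable" by (rule lmeasurable_compact)
    have lip: "\<exists>d>0. \<forall>y\<in>ball x d. dist (Dv y) (Dv x) \<le> (b + 1) / r\<^sup>2 * dist y x" if "x \<in> S" for x
    proof -
      have x: "x \<in> ball x0 (5 * r)" "norm (Hv x) \<le> b / r\<^sup>2" using that r by (auto simp: S_def)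
      have "1 / r\<^sup>2 > 0" using r by simp
      then obtain d where d: "d > 0" "\<And>y. norm (y - x) < d \<Longrightarrow> norm (Dv y - Dv x - Hv x *v (y - x)) \<le> 1 / r\<^sup>2 * norm (y - x)"
        using C2_onD(2)[OF v x(1)] unfolding has_derivative_at_alt by blast
      have "dist (Dv y) (Dv x) \<le> (b + 1) / r\<^sup>2 * dist y x" if "y \<in> ball x d" for y
      proof -
        have "norm (Dv y - Dv x) \<le> norm (Dv y - Dv x - Hv x *v (y - x)) + norm (Hv x *v (y - x))"
          using norm_triangle_ineq[of "Dv y - Dv x - Hv x *v (y - x)" "Hv x *v (y - x)"] by simp
        also have "\<dots> \<le> 1 / r\<^sup>2 * norm (y - x) + b / r\<^sup>2 * norm (y - x)"
          using that by (intro add_mono d order_trans[OF norm_matrix_vector_le] mult_right_mono x)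
            (auto simp: dist_norm norm_minus_commute)
        finally show ?thesis by (simp add: dist_norm algebra_simps add_divide_distrib)
      qed
      then show ?thesis using d(1) by blast
    qed
    have b1: "b + 1 \<noteq> 0" using b by simp
    define V where "V = measure lebesgue (ball (0::real^'n) 1)"
    have "measure lebesgue (cball (0::real^'n) (1 / (8 * r))) \<le> (5 * ((b + 1) / r\<^sup>2)) ^ DIM(real^'n) * measure lebesgue S"
      by (rule measure_pointwise_Lipschitz_image[OF Sm _ _ _ lip]) (use touch r b in auto)
    then have "(1 / (8 * r)) ^ CARD('n) * V \<le> (5 * ((b + 1) / r\<^sup>2)) ^ CARD('n) * measure lebesgue S"
      using measure_ball_scale(2)[of "1 / (8 * r)" "0::real^'n"] r by (simp add: V_def)
    then have "(r\<^sup>2 / (5 * (b + 1))) ^ CARD('n) * ((1 / (8 * r)) ^ CARD('n) * V)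
       \<le> (r\<^sup>2 / (5 * (b + 1))) ^ CARD('n) * ((5 * ((b + 1) / r\<^sup>2)) ^ CARD('n) * measure lebesgue S)"
      using b r by (intro mult_left_mono) auto
    also have "\<dots> = (r\<^sup>2 / (5 * (b + 1)) * (5 * ((b + 1) / r\<^sup>2))) ^ CARD('n) * measure lebesgue S"
      by (simp only: power_mult_distrib mult_ac)
    also have "r\<^sup>2 / (5 * (b + 1)) * (5 * ((b + 1) / r\<^sup>2)) = 1" using b1 r by simp
    also have "(r\<^sup>2 / (5 * (b + 1))) ^ CARD('n) * ((1 / (8 * r)) ^ CARD('n) * V)
       = (r\<^sup>2 / (5 * (b + 1)) * (1 / (8 * r))) ^ CARD('n) * V"
      by (simp only: power_mult_distrib mult_ac)
    also have "r\<^sup>2 / (5 * (b + 1)) * (1 / (8 * r)) = 1 / (40 * (b + 1)) * r"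
      using b1 r by (simp add: power2_eq_square)
    also have "(1 / (40 * (b + 1)) * r) ^ CARD('n) * V = \<mu> * measure lebesgue (ball x0 r)"
      using measure_ball_scale(1)[of r x0] r by (simp only: \<mu>_def V_def power_mult_distrib) simp
    finally have "\<mu> * measure lebesgue (ball x0 r) \<le> measure lebesgue S" by simp
    also have "\<dots> \<le> measure lebesgue {x \<in> cball x0 r. w x \<le> \<beta>}"
    proof (rule measure_mono_fmeasurable)
      have "closed (cball x0 r \<inter> w -` {..\<beta>})"
        by (intro continuous_closed_preimage wc) auto
      moreover have "cball x0 r \<inter> w -` {..\<beta>} = {x \<in> cball x0 r. w x \<le> \<beta>}" by auto
      ultimately have "compact {x \<in> cball x0 r. w x \<le> \<beta>}"
        by (metis bounded_cball bounded_Int compact_eq_bounded_closed)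
      then show "{x \<in> cball x0 r. w x \<le> \<beta>} \<in> lmeasurable" by (rule lmeasurable_compact)
    qed (use Sm in \<open>auto simp: S_def\<close>)
    finally show "\<mu> * measure lebesgue (ball x0 r) \<le> measure lebesgue {x \<in> cball x0 r. w x \<le> \<beta>}" .
  qed
qed

section \<open>From one small value to small superlevel sets\<close>

lemma lmeasurable_ball_ge:
  fixes f :: "'a::euclidean_space \<Rightarrow> real"
  assumes "continuous_on (ball x0 r) f"
  shows "{x \<in> ball x0 r. b \<le> f x} \<in> lmeasurable"
proof -
  have "closedin (top_of_set (ball x0 r)) (ball x0 r \<inter> f -` {b..})"
    by (intro continuous_closedin_preimage assms) auto
  then obtain T where T: "closed T" "ball x0 r \<inter> f -` {b..} = ball x0 r \<inter> T"
    by (auto simp: closedin_closed)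
  have "{x \<in> ball x0 r. b \<le> f x} = ball x0 r \<inter> f -` {b..}" by auto
  moreover have "ball x0 r \<inter> T \<in> lmeasurable"
    using T(1) by (intro fmeasurable_Int_fmeasurable) auto
  ultimately show ?thesis using T(2) by simp
qed

text \<open>A stopping-time argument with balls in place of dyadic cubes. Around each point of
  \<open>E\<close> the balls shrink until \<open>E\<close> is dense in one of them; the preceding
  ball lies in \<open>G\<close>, yet a share \<open>\<mu>\<close> of it misses \<open>E\<close>.
  Disjoint such balls therefore occupy a definite part of \<open>G - E\<close>, and their fivefold
  enlargements cover \<open>E\<close>.\<close>

lemma ink_spots:
  fixes x0 :: "'a::euclidean_space"
  assumes r: "0 < r" and \<mu>: "0 < \<mu>" "\<mu> < 1" and E: "open E" "E \<subseteq> G" and G: "G \<subseteq> ball x0 r" "G \<in> lmeasurable"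
    and sparse: "measure lebesgue E \<le> (1 - \<mu>) * measure lebesgue (ball x0 r)"
    and dense: "\<And>y \<rho>. 0 < \<rho> \<Longrightarrow> ball y \<rho> \<subseteq> ball x0 r \<Longrightarrow>
      (1 - \<mu>) * measure lebesgue (ball y \<rho>) < measure lebesgue (E \<inter> ball y \<rho>) \<Longrightarrow> ball y (3 * \<rho>) \<inter> ball x0 r \<subseteq> G"
  shows "(1 + \<mu> / 5 ^ DIM('a)) * measure lebesgue E \<le> measure lebesgue G"
proof -
  let ?m = "measure lebesgue"
  have Em: "E \<in> lmeasurable"
    using E G by (meson bounded_ball bounded_subset lmeasurable_open subset_trans)
  have "\<exists>y \<rho>. 0 < \<rho> \<and> \<rho> \<le> r \<and> x \<in> ball y \<rho> \<and> ball y \<rho> \<subseteq> G \<and> ?m (E \<inter> ball y \<rho>) \<le> (1 - \<mu>) * ?m (ball y \<rho>)"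
    if x: "x \<in> E" for x
  proof -
    \<comment> \<open>The centres slide from \<open>x0\<close> to \<open>x\<close> while the radii
      halve, so every ball contains \<open>x\<close> and stays inside \<open>ball x0 r\<close>, even
      for \<open>x\<close> near the boundary.\<close>
    define c where "c = (\<lambda>k::nat. x0 + (1 - (1/2) ^ k) *\<^sub>R (x - x0))"
    define \<rho> where "\<rho> = (\<lambda>k::nat. (1/2) ^ k * r)"
    define P where "P = (\<lambda>k. (1 - \<mu>) * ?m (ball (c k) (\<rho> k)) < ?m (E \<inter> ball (c k) (\<rho> k)))"
    have xr: "norm (x - x0) < r" using x E G by (auto simp: dist_norm norm_minus_commute)
    have \<rho>: "0 < \<rho> k" "\<rho> k \<le> r" for k using r by (auto simp: \<rho>_def mult_left_le_one_le power_le_one)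
    have xc: "x \<in> ball (c k) (\<rho> k)" for k
    proof -
      have "c k - x = - ((1/2) ^ k *\<^sub>R (x - x0))" by (simp add: c_def algebra_simps)
      then show ?thesis using xr by (simp add: dist_norm \<rho>_def)
    qed
    have sub: "ball (c k) (\<rho> k) \<subseteq> ball x0 r" for k
    proof -
      have "(1/2::real) ^ k \<le> 1" by (simp add: power_le_one)
      then have "dist (c k) x0 = (1 - (1/2) ^ k) * norm (x - x0)" by (simp add: c_def dist_norm)
      also have "\<dots> \<le> (1 - (1/2) ^ k) * r" using xr \<open>_ \<le> 1\<close> by (intro mult_left_mono) auto
      finally show ?thesis by (subst ball_subset_ball_iff) (simp add: \<rho>_def algebra_simps)
    qed
    have "\<not> P 0" using sparse E G by (simp add: P_def c_def \<rho>_def Int_absorb2 subset_trans not_less)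
    obtain K where "P K"
    proof -
      obtain e where e: "e > 0" "ball x e \<subseteq> E" using E x open_contains_ball by blast
      obtain K where K: "(1/2::real) ^ K < e / (2 * r)" using real_arch_pow_inv[of "e / (2 * r)" "1/2"] e r by auto
      have "ball (c K) (\<rho> K) \<subseteq> ball x e"
      proof
        fix y assume "y \<in> ball (c K) (\<rho> K)"
        then have "dist x y < 2 * \<rho> K" using xc[of K] dist_triangle[of x y "c K"] by (auto simp: dist_commute)
        also have "2 * \<rho> K < e" using K r by (simp add: \<rho>_def field_simps)
        finally show "y \<in> ball x e" by simp
      qed
      then have "E \<inter> ball (c K) (\<rho> K) = ball (c K) (\<rho> K)" using e by blast
      moreover have "0 < ?m (ball (c K) (\<rho> K))" using \<rho>(1)[of K] by simp
      ultimately show thesis using \<mu> by (intro that[of K]) (simp add: P_def del: content_ball_gt_0_iff)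
    qed
    \<comment> \<open>Density fails at index 0 by \<open>sparse\<close> and holds once the ball fits
      into the open set \<open>E\<close>; the stopping index lies between.\<close>
    have "\<exists>k. \<not> P k \<and> P (Suc k)"
    proof (rule ccontr)
      assume "\<not> ?thesis"
      then have "\<not> P j" for j using \<open>\<not> P 0\<close> by (induction j) auto
      then show False using \<open>P K\<close> by blast
    qed
    then obtain k where k: "\<not> P k" "P (Suc k)" by blast
    \<comment> \<open>The parent has twice the radius and its centre is at most one small radius
      away, which explains the factor 3 in \<open>dense\<close>.\<close>
    have "ball (c k) (\<rho> k) \<subseteq> ball (c (Suc k)) (3 * \<rho> (Suc k))"
    proof -
      have "c k - c (Suc k) = - ((1/2) ^ Suc k *\<^sub>R (x - x0))" by (simp add: c_def algebra_simps flip: scaleR_add_left)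
      then have "dist (c k) (c (Suc k)) \<le> \<rho> (Suc k)"
        using xr by (simp add: dist_norm \<rho>_def)
      then show ?thesis by (subst ball_subset_ball_iff) (simp add: \<rho>_def mult.commute)
    qed
    moreover have "ball (c (Suc k)) (3 * \<rho> (Suc k)) \<inter> ball x0 r \<subseteq> G"
      using k(2) by (intro dense \<rho> sub) (simp add: P_def)
    ultimately have "ball (c k) (\<rho> k) \<subseteq> G" using sub[of k] by blast
    then show ?thesis using \<rho>[of k] xc[of k] k(1) by (intro exI[of _ "c k"] exI[of _ "\<rho> k"]) (auto simp: P_def)
  qed
  then have "\<exists>a. \<forall>x\<in>E. \<exists>\<rho>. 0 < \<rho> \<and> \<rho> \<le> r \<and> x \<in> ball (a x) \<rho> \<and> ball (a x) \<rho> \<subseteq> G \<and>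
      ?m (E \<inter> ball (a x) \<rho>) \<le> (1 - \<mu>) * ?m (ball (a x) \<rho>)" by (intro bchoice ballI)
  then obtain a where "\<forall>x\<in>E. \<exists>\<rho>. 0 < \<rho> \<and> \<rho> \<le> r \<and> x \<in> ball (a x) \<rho> \<and> ball (a x) \<rho> \<subseteq> G \<and>
      ?m (E \<inter> ball (a x) \<rho>) \<le> (1 - \<mu>) * ?m (ball (a x) \<rho>)" by (rule exE)
  then have "\<exists>\<rho>. \<forall>x\<in>E. 0 < \<rho> x \<and> \<rho> x \<le> r \<and> x \<in> ball (a x) (\<rho> x) \<and> ball (a x) (\<rho> x) \<subseteq> G \<and>
      ?m (E \<inter> ball (a x) (\<rho> x)) \<le> (1 - \<mu>) * ?m (ball (a x) (\<rho> x))" by (rule bchoice)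
  then obtain \<rho> where "\<forall>x\<in>E. 0 < \<rho> x \<and> \<rho> x \<le> r \<and> x \<in> ball (a x) (\<rho> x) \<and> ball (a x) (\<rho> x) \<subseteq> G \<and>
      ?m (E \<inter> ball (a x) (\<rho> x)) \<le> (1 - \<mu>) * ?m (ball (a x) (\<rho> x))" by (rule exE)
  then have f: "\<And>x. x \<in> E \<Longrightarrow> 0 < \<rho> x \<and> \<rho> x \<le> r" "\<And>x. x \<in> E \<Longrightarrow> x \<in> ball (a x) (\<rho> x)"
      "\<And>x. x \<in> E \<Longrightarrow> ball (a x) (\<rho> x) \<subseteq> G"
      "\<And>x. x \<in> E \<Longrightarrow> ?m (E \<inter> ball (a x) (\<rho> x)) \<le> (1 - \<mu>) * ?m (ball (a x) (\<rho> x))"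
    by blast+
  have cov: "E \<subseteq> (\<Union>x\<in>E. ball (a x) (\<rho> x))" using f(2) by blast
  obtain C where C: "countable C" "C \<subseteq> E" "pairwise (\<lambda>i j. disjnt (ball (a i) (\<rho> i)) (ball (a j) (\<rho> j))) C"
      "E \<subseteq> (\<Union>i\<in>C. ball (a i) (5 * \<rho> i))"
    by (rule Vitali_covering_lemma_balls[OF cov f(1)])
  define q where "q = (5::real) ^ DIM('a)"
  have q: "q > 0" by (simp add: q_def)
  have fin: "?m (\<Union>i\<in>F. ball (a i) (5 * \<rho> i)) \<le> q / \<mu> * ?m (G - E)" if F: "finite F" "F \<subseteq> C" for F
  proof -
    have "?m (\<Union>i\<in>F. ball (a i) (5 * \<rho> i)) \<le> (\<Sum>i\<in>F. ?m (ball (a i) (5 * \<rho> i)))"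
      by (intro measure_UNION_le F) auto
    also have "\<dots> \<le> (\<Sum>i\<in>F. q / \<mu> * ?m (ball (a i) (\<rho> i) - E))"
    proof (rule sum_mono)
      fix i assume "i \<in> F"
      then have i: "i \<in> E" using F C by blast
      have "ball (a i) (\<rho> i) - E = ball (a i) (\<rho> i) - (E \<inter> ball (a i) (\<rho> i))" by blast
      then have "?m (ball (a i) (\<rho> i) - E) = ?m (ball (a i) (\<rho> i)) - ?m (E \<inter> ball (a i) (\<rho> i))"
        using Em by (metis Int_lower2 fmeasurableD lmeasurable_ball measurable_measure_Diff fmeasurable.Int)
      then have "\<mu> * ?m (ball (a i) (\<rho> i)) \<le> ?m (ball (a i) (\<rho> i) - E)"
        using f(4)[OF i] by (simp add: algebra_simps)
      then have "q / \<mu> * (\<mu> * ?m (ball (a i) (\<rho> i))) \<le> q / \<mu> * ?m (ball (a i) (\<rho> i) - E)"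
        using q \<mu> by (intro mult_left_mono) auto
      moreover have "?m (ball (a i) (5 * \<rho> i)) = q * ?m (ball (a i) (\<rho> i))"
        using measure_ball_scale(1)[of "5 * \<rho> i" "a i"] measure_ball_scale(1)[of "\<rho> i" "a i"] f(1)[OF i]
        by (simp only: q_def power_mult_distrib) simp
      ultimately show "?m (ball (a i) (5 * \<rho> i)) \<le> q / \<mu> * ?m (ball (a i) (\<rho> i) - E)"
        using \<mu> by simp
    qed
    also have "\<dots> = q / \<mu> * (\<Sum>i\<in>F. ?m (ball (a i) (\<rho> i) - E))" by (simp add: sum_distrib_left)
    also have "(\<Sum>i\<in>F. ?m (ball (a i) (\<rho> i) - E)) = ?m (\<Union>i\<in>F. ball (a i) (\<rho> i) - E)"
    proof (rule measure_finite_Union[symmetric])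
      show "disjoint_family_on (\<lambda>i. ball (a i) (\<rho> i) - E) F"
        using C(3) F unfolding disjoint_family_on_def pairwise_def disjnt_def by blast
      show "(\<lambda>i. ball (a i) (\<rho> i) - E) ` F \<subseteq> sets lebesgue"
        using Em by (auto intro!: sets.Diff fmeasurableD)
      show "emeasure lebesgue (ball (a i) (\<rho> i) - E) \<noteq> \<infinity>" if "i \<in> F" for i
        using fmeasurableD2[OF fmeasurable.Diff[OF lmeasurable_ball Em]] by auto
    qed (use F in auto)
    also have "q / \<mu> * ?m (\<Union>i\<in>F. ball (a i) (\<rho> i) - E) \<le> q / \<mu> * ?m (G - E)"
    proof (intro mult_left_mono measure_mono_fmeasurable)
      show "(\<Union>i\<in>F. ball (a i) (\<rho> i) - E) \<subseteq> G - E" using F C(2) f(3) by blast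
      show "(\<Union>i\<in>F. ball (a i) (\<rho> i) - E) \<in> sets lebesgue"
        using F fmeasurableD[OF Em] by (intro sets.finite_UN sets.Diff) auto
    qed (use G Em q \<mu> in \<open>auto intro!: fmeasurable.Diff\<close>)
    finally show ?thesis .
  qed
  have UC: "(\<Union>i\<in>C. ball (a i) (5 * \<rho> i)) \<in> lmeasurable"
    by (rule fmeasurable_UN_bound[OF C(1) _ fin]) auto
  have "?m E \<le> ?m (\<Union>i\<in>C. ball (a i) (5 * \<rho> i))"
    by (rule measure_mono_fmeasurable[OF C(4) fmeasurableD[OF Em] UC])
  also have "\<dots> \<le> q / \<mu> * ?m (G - E)"
    by (rule measure_UN_bound[OF C(1) _ fin]) auto
  also have "?m (G - E) = ?m G - ?m E"
    using G Em E by (intro measurable_measure_Diff) (auto intro: fmeasurableD)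
  finally have "\<mu> / q * ?m E \<le> \<mu> / q * (q / \<mu> * (?m G - ?m E))" using q \<mu> by (intro mult_left_mono) auto
  then show ?thesis using q \<mu> by (simp add: q_def[symmetric] algebra_simps)
qed

lemma C2_on_scale:
  assumes "C2_on S u Du H"
  shows "C2_on S (\<lambda>x. c * u x) (\<lambda>x. c *\<^sub>R Du x) (\<lambda>x. c *\<^sub>R H x)"
  using assms unfolding C2_on_def scaleR_matrix_vector_assoc[symmetric] inner_scaleR_left
  by (auto intro!: continuous_intros intro: has_derivative_mult_right has_derivative_scaleR_right)

lemma supersolution_on_scale:
  assumes "supersolution_on lam Lam S H" "0 \<le> c"
  shows "supersolution_on lam Lam S (\<lambda>x. c *\<^sub>R H x)"
  unfolding supersolution_on_def
proof
  fix x assume "x \<in> S"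
  then obtain L where L: "elliptic lam Lam L" "L (H x) \<le> 0" using assms by (auto simp: supersolution_on_def)
  then have "L (c *\<^sub>R H x) = c * L (H x)" by (simp add: elliptic_def linear_scale)
  then show "\<exists>L. elliptic lam Lam L \<and> L (c *\<^sub>R H x) \<le> 0"
    using L assms(2) by (metis mult_nonneg_nonpos)
qed

text \<open>If \<open>w\<close> were below \<open>s = t / M ^ (k + 2)\<close> at one point, the
  superlevel sets at \<open>s * M ^ j\<close> would lose a fixed fraction of measure per step, and
  the set where \<open>w \<ge> t\<close> would be too small. The given density
  \<open>\<delta>\<close> may be arbitrarily small and influences only the number of steps.\<close>

lemma supersolution_growth:
  fixes lam Lam \<delta> :: real
  assumes ell: "0 < lam" "lam \<le> Lam" and "0 < \<delta>"
  obtains c :: real where "0 < c" "c < 1"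
    "\<And>w Dw H (x0::real^'n) r t x. 0 < r \<Longrightarrow> C2_on (ball x0 (6 * r)) w Dw H \<Longrightarrow>
       supersolution_on lam Lam (ball x0 (6 * r)) H \<Longrightarrow> (\<And>x. x \<in> ball x0 (6 * r) \<Longrightarrow> 0 \<le> w x) \<Longrightarrow>
       0 < t \<Longrightarrow> \<delta> * measure lebesgue (ball x0 r) \<le> measure lebesgue {x \<in> ball x0 r. t \<le> w x} \<Longrightarrow>
       x \<in> ball x0 r \<Longrightarrow> c * t \<le> w x"
proof -
  obtain M \<mu> :: real where M: "M > 1" and \<mu>: "0 < \<mu>" "\<mu> < 1"
    and point: "\<And>w Dw H (x0::real^'n) r z. 0 < r \<Longrightarrow> C2_on (ball x0 (5 * r)) w Dw H \<Longrightarrow>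
       supersolution_on lam Lam (ball x0 (5 * r)) H \<Longrightarrow> (\<And>x. x \<in> ball x0 (5 * r) \<Longrightarrow> 0 \<le> w x) \<Longrightarrow>
       z \<in> cball x0 (3 * r) \<Longrightarrow> w z \<le> 1 \<Longrightarrow>
       \<mu> * measure lebesgue (ball x0 r) \<le> measure lebesgue {x \<in> cball x0 r. w x \<le> M}"
    using supersolution_point_to_measure[OF ell, where 'n='n] by blast
  define q where "q = 1 / (1 + \<mu> / 5 ^ CARD('n))"
  have den: "1 < 1 + \<mu> / 5 ^ CARD('n)" using \<mu> by simp
  have q: "0 < q" "q < 1" using den by (auto simp: q_def)
  obtain k where k: "q ^ k < \<delta>" using real_arch_pow_inv[OF \<open>0 < \<delta>\<close> q(2)] by blast
  show thesis
  \<comment> \<open>\<open>E 1\<close> starts the iteration, so \<open>k\<close> steps reach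
    \<open>E (Suc k)\<close>, whose level is \<open>s * M ^ (k + 1) = t / M\<close>. The spare power
    of \<open>M\<close> puts this level strictly below \<open>t\<close>, as the strict inequality in
    \<open>E\<close> demands.\<close>
  proof (rule that[of "1 / M ^ (k + 2)"])
    have "1 < M ^ (k + 2)" using M by (intro one_less_power) auto
    then show "0 < 1 / M ^ (k + 2)" "1 / M ^ (k + 2) < 1" by auto
    fix w Dw H and x0 x :: "real^'n" and r t :: real
    assume r: "0 < r" and w: "C2_on (ball x0 (6 * r)) w Dw H"
      and super: "supersolution_on lam Lam (ball x0 (6 * r)) H"
      and nonneg: "\<And>x. x \<in> ball x0 (6 * r) \<Longrightarrow> 0 \<le> w x" and t: "0 < t"
      and meas: "\<delta> * measure lebesgue (ball x0 r) \<le> measure lebesgue {x \<in> ball x0 r. t \<le> w x}"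
      and x: "x \<in> ball x0 r"
    let ?m = "measure lebesgue"
    show "1 / M ^ (k + 2) * t \<le> w x"
    proof (rule ccontr)
      assume neg: "\<not> ?thesis"
      define s where "s = t / M ^ (k + 2)"
      have s: "0 < s" using t M by (simp add: s_def)
      have wx: "w x < s" using neg by (simp add: s_def)
      define E where "E = (\<lambda>j::nat. {y \<in> ball x0 r. s * M ^ j < w y})"
      have wcont: "continuous_on (ball x0 r) w"
        using C2_on_imp_continuous_on[OF w] by (rule continuous_on_subset) (use r in auto)
      have openE: "open (E j)" for j
      proof -
        have "open (ball x0 r \<inter> w -` {s * M ^ j<..})" by (intro continuous_open_preimage wcont) auto
        moreover have "ball x0 r \<inter> w -` {s * M ^ j<..} = E j" by (auto simp: E_def)
        ultimately show ?thesis by simp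
      qed
      have Esub: "E j \<subseteq> ball x0 r" for j by (auto simp: E_def)
      have Em: "E j \<in> lmeasurable" for j
        using openE Esub by (meson bounded_ball bounded_subset lmeasurable_open)
      have Emono: "E (Suc j) \<subseteq> E j" for j
      proof -
        have "s * M ^ j \<le> s * M ^ Suc j" using s M by simp
        then show ?thesis unfolding E_def by auto
      qed
      \<comment> \<open>Contrapositive of \<open>point\<close> for \<open>w\<close> divided by
        \<open>s * M ^ j\<close>: one point of the tripled ball with
        \<open>w \<le> s * M ^ j\<close> would keep a share \<open>\<mu>\<close> of
        \<open>ball y \<rho>\<close> outside \<open>E (Suc j)\<close>.\<close>
      have dense: "ball y (3 * \<rho>) \<inter> ball x0 r \<subseteq> E j"
        if \<rho>: "0 < \<rho>" "ball y \<rho> \<subseteq> ball x0 r" and d: "(1 - \<mu>) * ?m (ball y \<rho>) < ?m (E (Suc j) \<inter> ball y \<rho>)" for y \<rho> j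
      proof (rule ccontr)
        assume "\<not> ?thesis"
        then obtain z where z: "z \<in> ball y (3 * \<rho>)" "w z \<le> s * M ^ j" unfolding E_def by force
        have "dist y x0 + \<rho> \<le> r" using \<rho> by (simp add: ball_subset_ball_iff)
        then have "\<rho> \<le> r" using zero_le_dist[of y x0] by linarith
        have sub5: "ball y (5 * \<rho>) \<subseteq> ball x0 (6 * r)"
          using \<open>dist y x0 + \<rho> \<le> r\<close> \<open>\<rho> \<le> r\<close> r by (simp add: ball_subset_ball_iff)
        define v where "v = (\<lambda>x. 1 / (s * M ^ j) * w x)"
        have sM: "0 < s * M ^ j" using s M by simp
        have "\<mu> * ?m (ball y \<rho>) \<le> ?m {x \<in> cball y \<rho>. v x \<le> M}"
        proof (rule point[OF \<rho>(1)])
          show "C2_on (ball y (5 * \<rho>)) v (\<lambda>x. (1 / (s * M ^ j)) *\<^sub>R Dw x) (\<lambda>x. (1 / (s * M ^ j)) *\<^sub>R H x)"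
            unfolding v_def by (intro C2_on_scale C2_on_subset[OF w sub5])
          have "supersolution_on lam Lam (ball y (5 * \<rho>)) H"
            using super sub5 by (auto simp: supersolution_on_def)
          then show "supersolution_on lam Lam (ball y (5 * \<rho>)) (\<lambda>x. (1 / (s * M ^ j)) *\<^sub>R H x)"
            by (rule supersolution_on_scale) (use sM in simp)
          show "0 \<le> v x" if "x \<in> ball y (5 * \<rho>)" for x
            using nonneg[of x] sub5 that sM by (auto simp: v_def)
          show "z \<in> cball y (3 * \<rho>)" using z by auto
          show "v z \<le> 1" using z sM by (simp add: v_def)
        qed
        moreover have "{x \<in> cball y \<rho>. v x \<le> M} = {x \<in> cball y \<rho>. w x \<le> s * M ^ Suc j}"
          using sM by (auto simp: v_def divide_le_eq mult_ac)
        moreover define Q where "Q = {x \<in> cball y \<rho>. w x \<le> s * M ^ Suc j}"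
        ultimately have mQ: "\<mu> * ?m (ball y \<rho>) \<le> ?m Q" by simp
        have "cball y \<rho> \<subseteq> ball x0 (6 * r)" using sub5 \<rho> by (auto simp: subset_eq)
        then have "continuous_on (cball y \<rho>) w" using C2_on_imp_continuous_on[OF w] continuous_on_subset by blast
        then have "closed (cball y \<rho> \<inter> w -` {..s * M ^ Suc j})" by (intro continuous_closed_preimage) auto
        moreover have "cball y \<rho> \<inter> w -` {..s * M ^ Suc j} = Q" by (auto simp: Q_def)
        ultimately have "compact Q"
          by (metis bounded_cball bounded_Int compact_eq_bounded_closed)
        then have Qm: "Q \<in> lmeasurable" by (rule lmeasurable_compact)
        have EB: "E (Suc j) \<inter> ball y \<rho> \<in> lmeasurable" using Em
          by (intro fmeasurable_Int_fmeasurable) auto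
        have disj: "Q \<inter> (E (Suc j) \<inter> ball y \<rho>) = {}" unfolding Q_def E_def by fastforce
        have "emeasure lebesgue Q \<noteq> \<infinity>" "emeasure lebesgue (E (Suc j) \<inter> ball y \<rho>) \<noteq> \<infinity>"
          using fmeasurableD2[OF Qm] fmeasurableD2[OF EB] by simp_all
        from measure_Union[OF this fmeasurableD[OF Qm] fmeasurableD[OF EB] disj]
        have "?m Q + ?m (E (Suc j) \<inter> ball y \<rho>) = ?m (Q \<union> (E (Suc j) \<inter> ball y \<rho>))" by simp
        also have "\<dots> \<le> ?m (cball y \<rho>)"
        proof (rule measure_mono_fmeasurable)
          show "Q \<union> (E (Suc j) \<inter> ball y \<rho>) \<subseteq> cball y \<rho>" unfolding Q_def by auto
        qed (use Qm EB in \<open>auto intro: fmeasurableD\<close>)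
        also have "\<dots> = ?m (ball y \<rho>)" using measure_ball_scale[of \<rho> y] \<rho> by (simp del: content_ball_eq_0_iff)
        finally show False using mQ d by (simp add: algebra_simps)
      qed
      \<comment> \<open>Otherwise \<open>dense\<close> on the whole ball would put \<open>x\<close>
        into \<open>E 0\<close>, against \<open>w x < s\<close>. This gives the sparsity that
        \<open>ink_spots\<close> requires at every later level.\<close>
      have E1: "?m (E 1) \<le> (1 - \<mu>) * ?m (ball x0 r)"
      proof (rule ccontr)
        assume "\<not> ?thesis"
        moreover have "E 1 \<inter> ball x0 r = E 1" using Esub by blast
        ultimately have "ball x0 (3 * r) \<inter> ball x0 r \<subseteq> E 0" by (intro dense) (use r in auto)
        moreover have "x \<in> ball x0 (3 * r)" using x r by auto
        ultimately have "x \<in> E 0" using x by blast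
        then show False using wx by (simp add: E_def)
      qed
      have EjE1: "E (Suc j) \<subseteq> E 1" for j
        using lift_Suc_antimono_le[of E, OF Emono, of 1 "Suc j"] by simp
      have step: "?m (E (Suc (Suc j))) \<le> q * ?m (E (Suc j))" for j
      proof -
        have "(1 + \<mu> / 5 ^ DIM(real^'n)) * ?m (E (Suc (Suc j))) \<le> ?m (E (Suc j))"
        proof (rule ink_spots[OF r \<mu> openE Emono Esub Em _ dense])
          have "?m (E (Suc (Suc j))) \<le> ?m (E 1)"
            by (intro measure_mono_fmeasurable EjE1 Em fmeasurableD)
          then show "?m (E (Suc (Suc j))) \<le> (1 - \<mu>) * ?m (ball x0 r)" using E1 by linarith
        qed
        then have "?m (E (Suc (Suc j))) \<le> ?m (E (Suc j)) / (1 + \<mu> / 5 ^ CARD('n))"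
          using den by (subst pos_le_divide_eq) (auto simp: mult.commute)
        then show ?thesis by (simp add: q_def)
      qed
      have "?m (E (Suc j)) \<le> q ^ j * ?m (ball x0 r)" for j
      proof (induction j)
        case 0
        have "?m (E (Suc 0)) \<le> ?m (ball x0 r)"
          by (rule measure_mono_fmeasurable[OF Esub fmeasurableD[OF Em] lmeasurable_ball])
        then show ?case by simp
      next
        case (Suc j)
        have "?m (E (Suc (Suc j))) \<le> q * ?m (E (Suc j))" by (rule step)
        also have "\<dots> \<le> q * (q ^ j * ?m (ball x0 r))" using Suc q by (intro mult_left_mono) auto
        finally show ?case by simp
      qed
      from this[of k] have "?m (E (Suc k)) \<le> q ^ k * ?m (ball x0 r)" .
      moreover have "?m {x \<in> ball x0 r. t \<le> w x} \<le> ?m (E (Suc k))"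
      proof (rule measure_mono_fmeasurable[OF _ _ Em])
        have "s * M ^ Suc k < t"
          using t M by (simp add: s_def field_simps)
        then show "{x \<in> ball x0 r. t \<le> w x} \<subseteq> E (Suc k)" by (auto simp: E_def)
        show "{x \<in> ball x0 r. t \<le> w x} \<in> sets lebesgue"
          by (intro fmeasurableD lmeasurable_ball_ge wcont)
      qed
      moreover have "0 < ?m (ball x0 r)" using r by simp
      then have "q ^ k * ?m (ball x0 r) < \<delta> * ?m (ball x0 r)" using k by (intro mult_strict_right_mono)
      ultimately show False using meas by linarith
    qed
  qed
qed

subsection \<open>Oscillation of the Hessian\<close>

lemma C2_on_shift:
  assumes u: "C2_on S u Du H" and T: "\<And>x. x \<in> T \<Longrightarrow> x + a \<in> S"
  shows "C2_on T (\<lambda>x. u (x + a)) (\<lambda>x. Du (x + a)) (\<lambda>x. H (x + a))"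
  unfolding C2_on_def
proof (intro conjI ballI)
  fix x assume x: "x \<in> T"
  have sh: "((\<lambda>x. x + a) has_derivative (\<lambda>h. h)) (at x)" by (auto intro!: derivative_eq_intros)
  show "((\<lambda>x. u (x + a)) has_derivative (\<lambda>h. Du (x + a) \<bullet> h)) (at x)"
    by (rule has_derivative_compose[OF sh, of u, OF C2_onD(1)[OF u T[OF x]]])
  show "((\<lambda>x. Du (x + a)) has_derivative (\<lambda>h. H (x + a) *v h)) (at x)"
    by (rule has_derivative_compose[OF sh, of Du, OF C2_onD(2)[OF u T[OF x]]])
next
  show "continuous_on T (\<lambda>x. H (x + a))"
    by (rule continuous_on_compose2[OF C2_onD(3)[OF u]]) (auto intro!: continuous_intros T)
qed

lemma C2_on_const: "C2_on S (\<lambda>x. c) (\<lambda>x. 0) (\<lambda>x. 0)"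
  by (auto simp: C2_on_def matrix_vector_mult_0)

lemma ball_add_small:
  fixes x e :: "'a::real_normed_vector"
  assumes "x \<in> ball x0 s" "norm e = 1" "\<bar>t\<bar> \<le> h" "s + h \<le> s'"
  shows "x + t *\<^sub>R e \<in> ball x0 s'"
proof -
  have "dist x0 (x + t *\<^sub>R e) \<le> dist x0 x + dist x (x + t *\<^sub>R e)" by (rule dist_triangle)
  also have "dist x (x + t *\<^sub>R e) = \<bar>t\<bar>" using assms(2) by (simp add: dist_norm)
  finally show ?thesis using assms by auto
qed

text \<open>The equation enters through the existence of \<open>L\<close>: the values of the Hessian lie on one side of
  an elliptic hyperplane through each of them.\<close>

lemma pure_second_derivative_drop:
  fixes lam Lam \<delta> :: real
  assumes ell: "0 < lam" "lam \<le> Lam" and "0 < \<delta>"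
  obtains \<kappa> :: real where "0 < \<kappa>" "\<kappa> < 1"
    "\<And>(u :: real^'n \<Rightarrow> real) Du H x0 r e S t x. 0 < r \<Longrightarrow> C2_on (ball x0 (8 * r)) u Du H \<Longrightarrow>
      (\<And>x. x \<in> ball x0 (8 * r) \<Longrightarrow> \<exists>L. elliptic lam Lam L \<and> (\<forall>y\<in>ball x0 (8 * r). 0 \<le> L (H y - H x))) \<Longrightarrow>
      norm e = 1 \<Longrightarrow> (\<And>x. x \<in> ball x0 (8 * r) \<Longrightarrow> e \<bullet> (H x *v e) \<le> S) \<Longrightarrow> 0 < t \<Longrightarrow>
      \<delta> * measure lebesgue (ball x0 r) \<le> measure lebesgue {x \<in> ball x0 r. t \<le> S - e \<bullet> (H x *v e)} \<Longrightarrow>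
      x \<in> ball x0 r \<Longrightarrow> e \<bullet> (H x *v e) \<le> S - \<kappa> * t"
proof -
  obtain c :: real where c: "0 < c" "c < 1"
    and growth: "\<And>w Dw H (x0::real^'n) r t x. 0 < r \<Longrightarrow> C2_on (ball x0 (6 * r)) w Dw H \<Longrightarrow>
       supersolution_on lam Lam (ball x0 (6 * r)) H \<Longrightarrow> (\<And>x. x \<in> ball x0 (6 * r) \<Longrightarrow> 0 \<le> w x) \<Longrightarrow>
       0 < t \<Longrightarrow> \<delta> * measure lebesgue (ball x0 r) \<le> measure lebesgue {x \<in> ball x0 r. t \<le> w x} \<Longrightarrow>
       x \<in> ball x0 r \<Longrightarrow> c * t \<le> w x"
    using supersolution_growth[OF ell \<open>0 < \<delta>\<close>, where 'n='n] by blast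
  show thesis
  proof (rule that[of "c / 2"])
    fix u :: "real^'n \<Rightarrow> real" and Du H x0 r e S t x
    assume r: "0 < r" and u: "C2_on (ball x0 (8 * r)) u Du H"
      and tangent: "\<And>x. x \<in> ball x0 (8 * r) \<Longrightarrow> \<exists>L. elliptic lam Lam L \<and> (\<forall>y\<in>ball x0 (8 * r). 0 \<le> L (H y - H x))"
      and e: "norm e = 1" and S: "\<And>x. x \<in> ball x0 (8 * r) \<Longrightarrow> e \<bullet> (H x *v e) \<le> S" and t: "0 < t"
      and meas: "\<delta> * measure lebesgue (ball x0 r) \<le> measure lebesgue {x \<in> ball x0 r. t \<le> S - e \<bullet> (H x *v e)}"
      and x: "x \<in> ball x0 r"
    define g where "g = (\<lambda>x. e \<bullet> (H x *v e))"
    have gcont: "continuous_on (ball x0 (8 * r)) g"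
      unfolding g_def by (rule continuous_on_quadform[OF C2_onD(3)[OF u]])
    \<comment> \<open>A difference quotient equals \<open>g\<close> at a point shifted by less than
      \<open>h\<close>. Uniform continuity makes the resulting error smaller than
      \<open>t / 2\<close>, so the density hypothesis survives with \<open>t / 2\<close> in place of
      \<open>t\<close>; hence the witness \<open>c / 2\<close>.\<close>
    have "uniformly_continuous_on (cball x0 (7 * r)) g"
      by (rule compact_uniformly_continuous[OF continuous_on_subset[OF gcont]]) (use r in auto)
    then obtain \<eta> where \<eta>: "\<eta> > 0" "\<And>y z. y \<in> cball x0 (7 * r) \<Longrightarrow> z \<in> cball x0 (7 * r) \<Longrightarrow> dist z y < \<eta> \<Longrightarrow> dist (g z) (g y) < t / 2"
      using t unfolding uniformly_continuous_on_def by (meson half_gt_zero)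
    have lower: "c * (t / 2) \<le> S - (u (x + h *\<^sub>R e) + u (x - h *\<^sub>R e) - 2 * u x) / h\<^sup>2"
      if h: "0 < h" "h < min r \<eta>" for h
    proof -
      \<comment> \<open>\<open>S\<close> minus the second difference quotient, spelled as nested
        sums to match the closure rules for \<open>C2_on\<close>. Shrinking the radius from
        \<open>8 * r\<close> to \<open>6 * r\<close> leaves room for translates by
        \<open>h < r\<close>.\<close>
      define w where "w = (\<lambda>x. S + (- 1 / h\<^sup>2) * (u (x + h *\<^sub>R e) + (u (x + (- h) *\<^sub>R e) + (- 2) * u x)))"
      define Dw where "Dw = (\<lambda>x. 0 + (- 1 / h\<^sup>2) *\<^sub>R (Du (x + h *\<^sub>R e) + (Du (x + (- h) *\<^sub>R e) + (- 2) *\<^sub>R Du x)))"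
      define Hw where "Hw = (\<lambda>x. 0 + (- 1 / h\<^sup>2) *\<^sub>R (H (x + h *\<^sub>R e) + (H (x + (- h) *\<^sub>R e) + (- 2) *\<^sub>R H x)))"
      have shift: "y + s *\<^sub>R e \<in> ball x0 (8 * r)" if "y \<in> ball x0 (6 * r)" "\<bar>s\<bar> \<le> h" for y s
        by (rule ball_add_small[OF that(1) e that(2)]) (use h in auto)
      have w: "C2_on (ball x0 (6 * r)) w Dw Hw"
        unfolding w_def Dw_def Hw_def using h
        by (intro C2_on_add C2_on_const C2_on_scale C2_on_shift[OF u] shift C2_on_subset[OF u]) (use r in auto)
      have wval: "\<exists>s. \<bar>s\<bar> < h \<and> w y = S - g (y + s *\<^sub>R e)" if y: "y \<in> ball x0 (6 * r)" for y
      proof -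
        obtain s where s: "\<bar>s\<bar> < h" "u (y + h *\<^sub>R e) + u (y - h *\<^sub>R e) - 2 * u y = h\<^sup>2 * g (y + s *\<^sub>R e)"
          using second_difference[OF u h(1) shift[OF y]] unfolding g_def by blast
        have "w y = S - (u (y + h *\<^sub>R e) + u (y - h *\<^sub>R e) - 2 * u y) / h\<^sup>2" by (simp add: w_def)
        also have "\<dots> = S - g (y + s *\<^sub>R e)" using h unfolding s(2) by simp
        finally show ?thesis using s(1) by blast
      qed
      have "c * (t / 2) \<le> w x"
      proof (rule growth[OF r w])
        show "supersolution_on lam Lam (ball x0 (6 * r)) Hw"
          unfolding supersolution_on_def
        proof
          fix y assume y: "y \<in> ball x0 (6 * r)"
          then have "y \<in> ball x0 (8 * r)" using r by auto
          then obtain L where L: "elliptic lam Lam L" "\<And>z. z \<in> ball x0 (8 * r) \<Longrightarrow> 0 \<le> L (H z - H y)"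
            using tangent by blast
          have lin: "linear L" using L by (simp add: elliptic_def)
          \<comment> \<open>Both differences start at the same Hessian \<open>H y\<close>, so the
            single functional \<open>L\<close> belonging to \<open>y\<close> is nonnegative on both;
            the factor \<open>- 1 / h\<^sup>2\<close> reverses the sign.\<close>
          have "Hw y = (- 1 / h\<^sup>2) *\<^sub>R ((H (y + h *\<^sub>R e) - H y) + (H (y + (- h) *\<^sub>R e) - H y))"
            by (simp add: Hw_def scaleR_2 algebra_simps)
          then have "L (Hw y) = (- 1 / h\<^sup>2) * (L (H (y + h *\<^sub>R e) - H y) + L (H (y + (- h) *\<^sub>R e) - H y))"
            by (simp only: linear_scale[OF lin] linear_add[OF lin] real_scaleR_def)
          moreover have "0 \<le> L (H (y + h *\<^sub>R e) - H y) + L (H (y + (- h) *\<^sub>R e) - H y)"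
            using h by (intro add_nonneg_nonneg L shift y) auto
          ultimately have "L (Hw y) \<le> 0" by (simp add: mult_nonpos_nonneg)
          then show "\<exists>L. elliptic lam Lam L \<and> L (Hw y) \<le> 0" using L(1) by blast
        qed
        show "0 \<le> w y" if y: "y \<in> ball x0 (6 * r)" for y
        proof -
          obtain s where s: "\<bar>s\<bar> < h" "w y = S - g (y + s *\<^sub>R e)" using wval[OF y] by blast
          have "g (y + s *\<^sub>R e) \<le> S" unfolding g_def using s(1) by (intro S shift y) auto
          then show ?thesis using s(2) by simp
        qed
        have "measure lebesgue {x \<in> ball x0 r. t \<le> S - g x} \<le> measure lebesgue {x \<in> ball x0 r. t / 2 \<le> w x}"
        proof (rule measure_mono_fmeasurable)
          show "{x \<in> ball x0 r. t \<le> S - g x} \<subseteq> {x \<in> ball x0 r. t / 2 \<le> w x}"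
          proof safe
            fix y assume y: "y \<in> ball x0 r" "t \<le> S - g y"
            have y6: "y \<in> ball x0 (6 * r)" "y \<in> cball x0 (7 * r)" using y r by auto
            obtain s where s: "\<bar>s\<bar> < h" "w y = S - g (y + s *\<^sub>R e)" using wval[OF y6(1)] by blast
            have "y + s *\<^sub>R e \<in> ball x0 (7 * r)" by (rule ball_add_small[OF y6(1) e, of s h]) (use s h in auto)
            then have "dist (g (y + s *\<^sub>R e)) (g y) < t / 2"
              using s h e by (intro \<eta> y6) (auto simp: dist_norm)
            then have "g (y + s *\<^sub>R e) - g y < t / 2" unfolding dist_real_def by linarith
            then show "t / 2 \<le> w y" using s(2) y(2) by linarith
          qed
          show "{x \<in> ball x0 r. t / 2 \<le> w x} \<in> lmeasurable"
            by (intro lmeasurable_ball_ge continuous_on_subset[OF C2_on_imp_continuous_on[OF w]]) (use r in auto)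
          show "{x \<in> ball x0 r. t \<le> S - g x} \<in> sets lebesgue"
            by (intro fmeasurableD lmeasurable_ball_ge continuous_intros continuous_on_subset[OF gcont]) (use r in auto)
        qed
        then show "\<delta> * measure lebesgue (ball x0 r) \<le> measure lebesgue {x \<in> ball x0 r. t / 2 \<le> w x}"
          using meas unfolding g_def by linarith
      qed (use t x in auto)
      then show ?thesis by (simp add: w_def add_diff_eq)
    qed
    have "\<forall>\<^sub>F h in at_right 0. c * (t / 2) \<le> S - (u (x + h *\<^sub>R e) + u (x - h *\<^sub>R e) - 2 * u x) / h\<^sup>2"
      unfolding eventually_at_right[OF zero_less_one]
      by (rule exI[of _ "min r \<eta>"]) (use lower r \<eta>(1) in auto)
    moreover have "((\<lambda>h. S - (u (x + h *\<^sub>R e) + u (x - h *\<^sub>R e) - 2 * u x) / h\<^sup>2) \<longlongrightarrow> S - e \<bullet> (H x *v e)) (at_right 0)"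
      by (intro tendsto_diff tendsto_const second_difference_limit[OF u]) (use x r in auto)
    ultimately have "c * (t / 2) \<le> S - e \<bullet> (H x *v e)"
      by (intro tendsto_lowerbound[of _ _ "at_right 0"]) auto
    then show "e \<bullet> (H x *v e) \<le> S - c / 2 * t" by simp
  qed (use c in auto)
qed

section \<open>Geometric decay of oscillation and the Hoelder estimate at a centre\<close>

definition osc :: "'a set \<Rightarrow> ('a \<Rightarrow> real) \<Rightarrow> real" where
  "osc S f = Sup (f ` S) - Inf (f ` S)"

lemma diff_le_osc: "bounded (f ` S) \<Longrightarrow> x \<in> S \<Longrightarrow> y \<in> S \<Longrightarrow> f x - f y \<le> osc S f"
  unfolding osc_def
  by (intro diff_mono cSup_upper cInf_lower) (auto dest: bounded_imp_bdd_above bounded_imp_bdd_below)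

lemma osc_nonneg: "bounded (f ` S) \<Longrightarrow> S \<noteq> {} \<Longrightarrow> 0 \<le> osc S f"
  using diff_le_osc[of f S] by fastforce

lemma osc_le:
  assumes "S \<noteq> {}" "\<And>x y. x \<in> S \<Longrightarrow> y \<in> S \<Longrightarrow> f x - f y \<le> b"
  shows "osc S f \<le> b"
proof -
  have "f x \<le> b + Inf (f ` S)" if x: "x \<in> S" for x
  proof -
    have "f x - b \<le> Inf (f ` S)"
      by (rule cInf_greatest) (use assms(1) assms(2)[OF x] in \<open>auto simp: algebra_simps\<close>)
    then show ?thesis by simp
  qed
  then have "Sup (f ` S) \<le> b + Inf (f ` S)" using assms(1) by (intro cSup_least) auto
  then show ?thesis by (simp add: osc_def)
qed

lemma osc_mono: "bounded (f ` S) \<Longrightarrow> T \<subseteq> S \<Longrightarrow> T \<noteq> {} \<Longrightarrow> osc T f \<le> osc S f"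
  by (intro osc_le) (auto intro: diff_le_osc)

lemma bounded_quadform_image:
  fixes H :: "'a \<Rightarrow> real^'n^'n"
  assumes "\<And>x. x \<in> S \<Longrightarrow> norm (H x) \<le> K" "norm e = 1"
  shows "bounded ((\<lambda>x. e \<bullet> (H x *v e)) ` S)"
  unfolding bounded_iff
proof (intro exI[of _ K] ballI)
  fix v assume "v \<in> (\<lambda>x. e \<bullet> (H x *v e)) ` S"
  then obtain x where "x \<in> S" "v = e \<bullet> (H x *v e)" by auto
  then show "norm v \<le> K" using abs_quadform_le[of e "H x" e] assms by force
qed

text \<open>One direction drops by a fixed multiple of the total oscillation and the remaining ones
  do not increase. The net property is passed on with \<open>E\<close>, since the Hoelder estimate
  has to return from oscillations along this same \<open>E\<close> to the norm of the
  Hessian.\<close>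

lemma Hessian_osc_decay:
  fixes lam Lam :: real
  assumes ell: "0 < lam" "lam \<le> Lam"
  obtains E :: "(real^'n) set" and c \<theta> :: real where "finite E" "E \<noteq> {}" "0 < c" "0 < \<theta>" "\<theta> \<le> 1/2"
    "\<And>e. e \<in> E \<Longrightarrow> norm e = 1"
    "\<And>L D. elliptic lam Lam L \<Longrightarrow> transpose D = D \<Longrightarrow> L D \<ge> 0 \<Longrightarrow> \<exists>e\<in>E. c * norm D \<le> e \<bullet> (D *v e)"
    "\<And>(u :: real^'n \<Rightarrow> real) Du H x0 R K. 0 < R \<Longrightarrow> C2_on (ball x0 R) u Du H \<Longrightarrow>
      (\<And>x. x \<in> ball x0 R \<Longrightarrow> \<exists>L. elliptic lam Lam L \<and> (\<forall>y\<in>ball x0 R. 0 \<le> L (H y - H x))) \<Longrightarrow>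
      (\<And>x. x \<in> ball x0 R \<Longrightarrow> norm (H x) \<le> K) \<Longrightarrow>
      (\<Sum>e\<in>E. osc (ball x0 (R / 8)) (\<lambda>x. e \<bullet> (H x *v e)))
        \<le> (1 - \<theta>) * (\<Sum>e\<in>E. osc (ball x0 R) (\<lambda>x. e \<bullet> (H x *v e)))"
proof -
  obtain E :: "(real^'n) set" and c :: real where E: "finite E" "E \<noteq> {}" "0 < c" "\<And>e. e \<in> E \<Longrightarrow> norm e = 1"
    and net: "\<And>L D. elliptic lam Lam L \<Longrightarrow> transpose D = D \<Longrightarrow> L D \<ge> 0 \<Longrightarrow> \<exists>e\<in>E. c * norm D \<le> e \<bullet> (D *v e)"
    using elliptic_kernel_direction_net[OF ell, where 'n='n] by blast
  define m where "m = real (card E)"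
  have m: "m > 0" using E by (simp add: m_def card_gt_0_iff)
  \<comment> \<open>\<open>1 / m\<close> is the density that pigeonholing over the \<open>m\<close>
    directions guarantees, so the drop lemma is instantiated with it.\<close>
  then have "0 < 1 / m" by simp
  from pure_second_derivative_drop[OF ell this, where 'n='n] obtain \<kappa> :: real where \<kappa>: "0 < \<kappa>" "\<kappa> < 1"
    and drop: "\<And>(u :: real^'n \<Rightarrow> real) Du H x0 r e S t x. 0 < r \<Longrightarrow> C2_on (ball x0 (8 * r)) u Du H \<Longrightarrow>
      (\<And>x. x \<in> ball x0 (8 * r) \<Longrightarrow> \<exists>L. elliptic lam Lam L \<and> (\<forall>y\<in>ball x0 (8 * r). 0 \<le> L (H y - H x))) \<Longrightarrow>
      norm e = 1 \<Longrightarrow> (\<And>x. x \<in> ball x0 (8 * r) \<Longrightarrow> e \<bullet> (H x *v e) \<le> S) \<Longrightarrow> 0 < t \<Longrightarrow>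
      1 / m * measure lebesgue (ball x0 r) \<le> measure lebesgue {x \<in> ball x0 r. t \<le> S - e \<bullet> (H x *v e)} \<Longrightarrow>
      x \<in> ball x0 r \<Longrightarrow> e \<bullet> (H x *v e) \<le> S - \<kappa> * t"
    by blast
  \<comment> \<open>The drop \<open>\<kappa> * \<tau>\<close>, with
    \<open>\<tau> = c * \<omega> R / (4 * m)\<close>, is this fraction of \<open>\<omega> R\<close>.
    The cap 1/2 keeps \<open>1 - \<theta>\<close> above 1/8, so that the exponent derived from it is
    below 1.\<close>
  define \<theta> where "\<theta> = min (1/2) (\<kappa> * c / (4 * m))"
  have \<theta>: "0 < \<theta>" "\<theta> \<le> 1/2" using \<kappa> E m by (auto simp: \<theta>_def)
  show thesis
  proof (rule that[OF E(1-3) \<theta> E(4) net])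
    fix u :: "real^'n \<Rightarrow> real" and Du H x0 and R K :: real
    assume R: "0 < R" and u: "C2_on (ball x0 R) u Du H"
      and tangent: "\<And>x. x \<in> ball x0 R \<Longrightarrow> \<exists>L. elliptic lam Lam L \<and> (\<forall>y\<in>ball x0 R. 0 \<le> L (H y - H x))"
      and K: "\<And>x. x \<in> ball x0 R \<Longrightarrow> norm (H x) \<le> K"
    define g where "g = (\<lambda>e x. e \<bullet> (H x *v e))"
    define \<omega> where "\<omega> = (\<lambda>s. \<Sum>e\<in>E. osc (ball x0 s) (g e))"
    define r where "r = R / 8"
    have r: "0 < r" "8 * r = R" using R by (auto simp: r_def)
    have rsub: "ball x0 r \<subseteq> ball x0 R" using r by auto
    have ne: "ball x0 r \<noteq> {}" "ball x0 R \<noteq> {}" using r R by auto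
    have bd: "bounded (g e ` ball x0 R)" if "e \<in> E" for e
      unfolding g_def by (rule bounded_quadform_image[OF K E(4)[OF that]])
    have mono: "osc (ball x0 r) (g e) \<le> osc (ball x0 R) (g e)" if "e \<in> E" for e
      by (rule osc_mono[OF bd[OF that] rsub ne(1)])
    have "\<omega> r \<le> (1 - \<theta>) * \<omega> R"
    proof (cases "\<omega> R > 0")
      case False
      have "\<omega> r \<le> \<omega> R" unfolding \<omega>_def by (rule sum_mono[OF mono])
      moreover have "0 \<le> \<omega> R" unfolding \<omega>_def using bd ne by (intro sum_nonneg osc_nonneg) auto
      ultimately show ?thesis using False by simp
    next
      case True
      define \<tau> where "\<tau> = c * \<omega> R / (4 * m)"
      have \<tau>: "\<tau> > 0" using True E m by (simp add: \<tau>_def)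
      \<comment> \<open>Some direction carries at least the average \<open>\<omega> R / m\<close>;
        half of it gives a strict inequality, needed because the supremum and infimum on an open
        ball may not be attained.\<close>
      have "\<exists>e\<in>E. \<omega> R / (2 * m) < osc (ball x0 R) (g e)"
      proof (rule ccontr)
        assume "\<not> ?thesis"
        then have "\<omega> R \<le> of_nat (card E) * (\<omega> R / (2 * m))"
          unfolding \<omega>_def by (intro sum_bounded_above) (auto simp: not_less)
        also have "\<dots> = \<omega> R / 2" using m by (simp add: m_def)
        finally show False using True by simp
      qed
      then obtain e0 where e0: "e0 \<in> E" "\<omega> R / (2 * m) < osc (ball x0 R) (g e0)" by blast
      then have "\<not> (\<forall>x\<in>ball x0 R. \<forall>y\<in>ball x0 R. g e0 x - g e0 y \<le> \<omega> R / (2 * m))"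
        using osc_le[OF ne(2), of "g e0" "\<omega> R / (2 * m)"] by (meson not_le)
      then obtain y1 y2 where y: "y1 \<in> ball x0 R" "y2 \<in> ball x0 R" "\<omega> R / (2 * m) < g e0 y1 - g e0 y2"
        by (auto simp: not_le)
      have "g e0 y1 - g e0 y2 = e0 \<bullet> ((H y1 - H y2) *v e0)" by (simp add: g_def quadform_lincomb)
      also have "\<dots> \<le> norm (H y1 - H y2)"
        using abs_quadform_le[of e0 "H y1 - H y2" e0] E(4)[OF e0(1)] by simp
      finally have y12: "\<omega> R / (2 * m) < norm (H y1 - H y2)" using y(3) by linarith
      define S where "S = (\<lambda>e. Sup (g e ` ball x0 R))"
      have S: "g e x \<le> S e" if "e \<in> E" "x \<in> ball x0 R" for e x
        unfolding S_def using bd[OF that(1)] that(2) by (intro cSup_upper) (auto dest: bounded_imp_bdd_above)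
      define A where "A = (\<lambda>e. {x \<in> ball x0 r. \<tau> \<le> S e - g e x})"
      \<comment> \<open>\<open>H x\<close> cannot be close to both \<open>H y1\<close> and
        \<open>H y2\<close>. Against the farther one, the net yields a direction along which the
        value at \<open>x\<close> stays at least \<open>\<tau>\<close> below the supremum.\<close>
      have cover: "\<exists>e\<in>E. x \<in> A e" if x: "x \<in> ball x0 r" for x
      proof -
        have xR: "x \<in> ball x0 R" using x rsub by blast
        have "norm (H y1 - H y2) \<le> norm (H y1 - H x) + norm (H y2 - H x)"
          using norm_triangle_ineq4[of "H y1 - H x" "H y2 - H x"] by simp
        moreover have "\<omega> R / (2 * m) = 2 * (\<omega> R / (4 * m))" by simp
        ultimately have "\<omega> R / (4 * m) < norm (H y1 - H x) \<or> \<omega> R / (4 * m) < norm (H y2 - H x)"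
          using y12 by linarith
        then obtain y where yy: "y \<in> ball x0 R" "\<omega> R / (4 * m) < norm (H y - H x)" using y by blast
        obtain L where L: "elliptic lam Lam L" "0 \<le> L (H y - H x)" using tangent[OF xR] yy(1) by blast
        have "transpose (H y - H x) = H y - H x"
          using C2_on_Hessian_sym[OF u open_ball] yy(1) xR by (simp add: transpose_lincomb)
        from net[OF L(1) this L(2)] obtain e where e: "e \<in> E" "c * norm (H y - H x) \<le> e \<bullet> ((H y - H x) *v e)" by blast
        have "\<tau> = c * (\<omega> R / (4 * m))" by (simp add: \<tau>_def)
        also have "\<dots> \<le> c * norm (H y - H x)" using yy(2) E(3) by (intro mult_left_mono) auto
        also have "\<dots> \<le> g e y - g e x" using e(2) by (simp add: g_def quadform_lincomb)
        also have "\<dots> \<le> S e - g e x" using S[OF e(1) yy(1)] by simp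
        finally show ?thesis using e(1) x by (auto simp: A_def)
      qed
      have gcont: "continuous_on (ball x0 r) (g e)" for e
        unfolding g_def by (rule continuous_on_quadform[OF continuous_on_subset[OF C2_onD(3)[OF u] rsub]])
      have Am: "A e \<in> lmeasurable" for e
        unfolding A_def by (intro lmeasurable_ball_ge continuous_intros gcont)
      have "\<exists>e\<in>E. 1 / m * measure lebesgue (ball x0 r) \<le> measure lebesgue (A e)"
      proof (rule ccontr)
        assume "\<not> ?thesis"
        then have "(\<Sum>e\<in>E. measure lebesgue (A e)) < of_nat (card E) * (1 / m * measure lebesgue (ball x0 r))"
          using E by (intro sum_bounded_above_strict) (auto simp: not_le card_gt_0_iff)
        also have "\<dots> = measure lebesgue (ball x0 r)" using m by (simp add: m_def)
        also have "\<dots> \<le> measure lebesgue (\<Union>e\<in>E. A e)"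
        proof (rule measure_mono_fmeasurable)
          show "ball x0 r \<subseteq> (\<Union>e\<in>E. A e)" using cover by blast
        qed (use E Am in \<open>auto intro!: fmeasurable.finite_UN\<close>)
        also have "\<dots> \<le> (\<Sum>e\<in>E. measure lebesgue (A e))"
          using E Am by (intro measure_UNION_le) (auto intro: fmeasurableD)
        finally show False by simp
      qed
      then obtain e where e: "e \<in> E" "1 / m * measure lebesgue (ball x0 r) \<le> measure lebesgue (A e)" by blast
      have dropped: "g e x \<le> S e - \<kappa> * \<tau>" if "x \<in> ball x0 r" for x
        unfolding g_def
      proof (rule drop[OF r(1) _ _ E(4)[OF e(1)] _ \<tau> _ that, unfolded r(2), OF u tangent])
        show "e \<bullet> (H x *v e) \<le> S e" if "x \<in> ball x0 R" for x
          using S[OF e(1) that] by (simp add: g_def)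
        show "1 / m * measure lebesgue (ball x0 r) \<le> measure lebesgue {x \<in> ball x0 r. \<tau> \<le> S e - e \<bullet> (H x *v e)}"
          using e(2) by (simp add: A_def g_def)
      qed
      have "osc (ball x0 r) (g e) \<le> osc (ball x0 R) (g e) - \<kappa> * \<tau>"
      proof (rule osc_le[OF ne(1)])
        fix x y assume xy: "x \<in> ball x0 r" "y \<in> ball x0 r"
        have "Inf (g e ` ball x0 R) \<le> g e y"
          using bd[OF e(1)] xy(2) rsub by (intro cInf_lower) (auto dest: bounded_imp_bdd_below)
        then show "g e x - g e y \<le> osc (ball x0 R) (g e) - \<kappa> * \<tau>"
          using dropped[OF xy(1)] by (simp add: osc_def S_def)
      qed
      moreover have "(\<Sum>e'\<in>E - {e}. osc (ball x0 r) (g e')) \<le> (\<Sum>e'\<in>E - {e}. osc (ball x0 R) (g e'))"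
        by (intro sum_mono mono) auto
      ultimately have "\<omega> r \<le> \<omega> R - \<kappa> * \<tau>"
        unfolding \<omega>_def sum.remove[OF E(1) e(1)] by simp
      also have "\<dots> = (1 - \<kappa> * c / (4 * m)) * \<omega> R" by (simp add: \<tau>_def algebra_simps)
      also have "\<dots> \<le> (1 - \<theta>) * \<omega> R" using True by (intro mult_right_mono) (auto simp: \<theta>_def)
      finally show ?thesis .
    qed
    then show "(\<Sum>e\<in>E. osc (ball x0 (R / 8)) (\<lambda>x. e \<bullet> (H x *v e)))
        \<le> (1 - \<theta>) * (\<Sum>e\<in>E. osc (ball x0 R) (\<lambda>x. e \<bullet> (H x *v e)))"
      by (simp only: \<omega>_def g_def r_def)
  qed
qed

text \<open>Iterating the decay over the radii \<open>(1/8) ^ j * R\<close> bounds the summed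
  oscillation by a power of the radius; the net then bounds \<open>norm (H y - H x0)\<close> by one
  of the oscillations.\<close>

lemma Hessian_Holder_at_center:
  fixes lam Lam :: real
  assumes ell: "0 < lam" "lam \<le> Lam"
  obtains \<alpha> C :: real where "0 < \<alpha>" "\<alpha> < 1" "0 \<le> C"
    "\<And>(u :: real^'n \<Rightarrow> real) Du H x0 R K y. 0 < R \<Longrightarrow> C2_on (ball x0 R) u Du H \<Longrightarrow>
      (\<And>x. x \<in> ball x0 R \<Longrightarrow> \<exists>L. elliptic lam Lam L \<and> (\<forall>y\<in>ball x0 R. 0 \<le> L (H y - H x))) \<Longrightarrow>
      (\<And>x. x \<in> ball x0 R \<Longrightarrow> norm (H x) \<le> K) \<Longrightarrow> y \<in> ball x0 R \<Longrightarrow>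
      norm (H y - H x0) \<le> C * K * (dist y x0 / R) powr \<alpha>"
proof -
  show thesis
  proof (rule Hessian_osc_decay[OF ell, where 'n='n])
    fix E :: "(real^'n) set" and c \<theta> :: real
    assume E: "finite E" "E \<noteq> {}" "0 < c" and \<theta>: "0 < \<theta>" "\<theta> \<le> 1/2"
      and unit: "\<And>e. e \<in> E \<Longrightarrow> norm e = 1"
      and net: "\<And>L D. elliptic lam Lam L \<Longrightarrow> transpose D = D \<Longrightarrow> L D \<ge> 0 \<Longrightarrow> \<exists>e\<in>E. c * norm D \<le> e \<bullet> (D *v e)"
      and decay: "\<And>(u :: real^'n \<Rightarrow> real) Du H x0 R K. 0 < R \<Longrightarrow> C2_on (ball x0 R) u Du H \<Longrightarrow>
        (\<And>x. x \<in> ball x0 R \<Longrightarrow> \<exists>L. elliptic lam Lam L \<and> (\<forall>y\<in>ball x0 R. 0 \<le> L (H y - H x))) \<Longrightarrow>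
        (\<And>x. x \<in> ball x0 R \<Longrightarrow> norm (H x) \<le> K) \<Longrightarrow>
        (\<Sum>e\<in>E. osc (ball x0 (R / 8)) (\<lambda>x. e \<bullet> (H x *v e)))
          \<le> (1 - \<theta>) * (\<Sum>e\<in>E. osc (ball x0 R) (\<lambda>x. e \<bullet> (H x *v e)))"
    \<comment> \<open>Solves \<open>(1/8) powr \<alpha> = 1 - \<theta>\<close>, so \<open>j\<close>
      decay steps match the power \<open>\<alpha>\<close> of the radius ratio.\<close>
    define \<alpha> where "\<alpha> = ln (1 - \<theta>) / ln (1/8)"
    have ln8: "ln (1/8 :: real) < 0" by simp
    have "ln (1/8) < ln (1 - \<theta>)" "ln (1 - \<theta>) < 0" using \<theta> by auto
    then have \<alpha>: "0 < \<alpha>" "\<alpha> < 1" using ln8 unfolding \<alpha>_def by (auto simp: divide_neg_neg divide_less_eq)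
    have pow\<alpha>: "(1/8) powr \<alpha> = 1 - \<theta>" using \<theta> ln8 by (simp add: powr_def \<alpha>_def)
    show thesis
    \<comment> \<open>The constant collects 8 from rounding the distance to a power of 1/8,
      \<open>2 * K\<close> for each initial oscillation, \<open>card E\<close> summands, and
      \<open>1 / c\<close> from the net.\<close>
    proof (rule that[OF \<alpha>, of "16 * real (card E) / c"])
      show "0 \<le> 16 * real (card E) / c" using E by simp
      fix u :: "real^'n \<Rightarrow> real" and Du H x0 y and R K :: real
      assume R: "0 < R" and u: "C2_on (ball x0 R) u Du H"
        and tangent: "\<And>x. x \<in> ball x0 R \<Longrightarrow> \<exists>L. elliptic lam Lam L \<and> (\<forall>y\<in>ball x0 R. 0 \<le> L (H y - H x))"
        and K: "\<And>x. x \<in> ball x0 R \<Longrightarrow> norm (H x) \<le> K" and y: "y \<in> ball x0 R"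
      define g where "g = (\<lambda>e x. e \<bullet> (H x *v e))"
      define \<omega> where "\<omega> = (\<lambda>s. \<Sum>e\<in>E. osc (ball x0 s) (g e))"
      have K0: "0 \<le> K" using K[OF y] by (meson norm_ge_zero order_trans)
      have bd: "bounded (g e ` ball x0 s)" if "e \<in> E" "s \<le> R" for e s
        unfolding g_def by (rule bounded_quadform_image[OF K unit[OF that(1)]]) (use that in auto)
      have iter: "\<omega> ((1/8) ^ j * R) \<le> (1 - \<theta>) ^ j * \<omega> R" for j
      proof (induction j)
        case (Suc j)
        define s where "s = (1/8) ^ j * R"
        have s: "0 < s" "s \<le> R" using R by (auto simp: s_def mult_left_le_one_le power_le_one)
        have sub: "ball x0 s \<subseteq> ball x0 R" using s by auto
        have "(\<Sum>e\<in>E. osc (ball x0 (s / 8)) (\<lambda>x. e \<bullet> (H x *v e)))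
          \<le> (1 - \<theta>) * (\<Sum>e\<in>E. osc (ball x0 s) (\<lambda>x. e \<bullet> (H x *v e)))"
        proof (rule decay[OF s(1) C2_on_subset[OF u sub]])
          show "\<exists>L. elliptic lam Lam L \<and> (\<forall>y\<in>ball x0 s. 0 \<le> L (H y - H x))" if "x \<in> ball x0 s" for x
            using tangent[of x] that sub by blast
        qed (use K sub in blast)
        then have "\<omega> (s / 8) \<le> (1 - \<theta>) * \<omega> s" by (simp only: \<omega>_def g_def)
        also have "\<dots> \<le> (1 - \<theta>) * ((1 - \<theta>) ^ j * \<omega> R)"
          using Suc \<theta> by (intro mult_left_mono) (auto simp: s_def)
        finally show ?case by (simp add: s_def)
      qed simp
      show "norm (H y - H x0) \<le> 16 * real (card E) / c * K * (dist y x0 / R) powr \<alpha>"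
      proof (cases "y = x0")
        case False
        define d where "d = dist y x0 / R"
        have d: "0 < d" "d < 1" using False y R by (auto simp: d_def dist_commute)
        \<comment> \<open>The least \<open>N\<close> is positive because \<open>d < 1\<close>. Its
          predecessor \<open>j\<close> satisfies \<open>d < (1/8) ^ j \<le> 8 * d\<close>:
          \<open>y\<close> lies in the \<open>j\<close>-th ball, whose radius is comparable to the
          distance.\<close>
        define N where "N = (LEAST N. (1/8::real) ^ N \<le> d)"
        have "\<exists>N. (1/8::real) ^ N \<le> d" using real_arch_pow_inv[OF d(1), of "1/8"] by (auto intro: less_imp_le)
        then have N: "(1/8) ^ N \<le> d" unfolding N_def by (rule LeastI_ex)
        have "N \<noteq> 0" using N d by (intro notI) simp
        then obtain j where j: "N = Suc j" by (cases N) auto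
        have dj: "d < (1/8) ^ j" using not_less_Least[of j "\<lambda>N. (1/8::real) ^ N \<le> d"] j by (simp add: N_def)
        define s where "s = (1/8) ^ j * R"
        have s: "0 < s" "s \<le> R" using R by (auto simp: s_def mult_left_le_one_le power_le_one)
        have ys: "y \<in> ball x0 s" using dj R by (simp add: d_def s_def dist_commute divide_less_eq)
        have x0R: "x0 \<in> ball x0 R" using R by simp
        obtain L where L: "elliptic lam Lam L" "0 \<le> L (H y - H x0)" using tangent[OF x0R] y by blast
        have "transpose (H y - H x0) = H y - H x0"
          using C2_on_Hessian_sym[OF u open_ball] y x0R by (simp add: transpose_lincomb)
        from net[OF L(1) this L(2)] obtain e where e: "e \<in> E" "c * norm (H y - H x0) \<le> e \<bullet> ((H y - H x0) *v e)" by blast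
        note e(2)
        also have "e \<bullet> ((H y - H x0) *v e) = g e y - g e x0" by (simp add: g_def quadform_lincomb)
        also have "\<dots> \<le> osc (ball x0 s) (g e)" using s by (intro diff_le_osc bd e ys) auto
        also have "\<dots> \<le> \<omega> s"
          unfolding \<omega>_def using E e s bd by (intro member_le_sum osc_nonneg) auto
        also have "\<dots> \<le> (1 - \<theta>) ^ j * \<omega> R" unfolding s_def by (rule iter)
        also have "\<dots> \<le> (8 * d powr \<alpha>) * (of_nat (card E) * (2 * K))"
        proof (rule mult_mono)
          have "(1 - \<theta>) ^ j = ((1/8) ^ j) powr \<alpha>"
            unfolding pow\<alpha>[symmetric] by (simp add: powr_power powr_powr powr_realpow[symmetric] mult.commute)
          also have "\<dots> \<le> (8 * d) powr \<alpha>" using N \<alpha> by (intro powr_mono2) (auto simp: j)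
          also have "\<dots> = 8 powr \<alpha> * d powr \<alpha>" using d by (simp add: powr_mult)
          also have "\<dots> \<le> 8 powr 1 * d powr \<alpha>" using \<alpha> by (intro mult_right_mono powr_mono) auto
          finally show "(1 - \<theta>) ^ j \<le> 8 * d powr \<alpha>" by simp
          show "\<omega> R \<le> of_nat (card E) * (2 * K)"
            unfolding \<omega>_def
          proof (rule sum_bounded_above)
            fix e assume e: "e \<in> E"
            show "osc (ball x0 R) (g e) \<le> 2 * K"
            proof (rule osc_le)
              fix x z assume xz: "x \<in> ball x0 R" "z \<in> ball x0 R"
              have "\<bar>g e x\<bar> \<le> K" "\<bar>g e z\<bar> \<le> K"
                using abs_quadform_le[of e "H x" e] abs_quadform_le[of e "H z" e] K[OF xz(1)] K[OF xz(2)] unit[OF e]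
                by (auto simp: g_def)
              then show "g e x - g e z \<le> 2 * K" by linarith
            qed (use R in auto)
          qed
          show "0 \<le> \<omega> R" unfolding \<omega>_def using bd R by (intro sum_nonneg osc_nonneg) auto
        qed simp
        finally have "norm (H y - H x0) \<le> (8 * d powr \<alpha>) * (of_nat (card E) * (2 * K)) / c"
          using E(3) by (simp add: pos_le_divide_eq mult.commute)
        then show ?thesis by (simp add: d_def mult_ac)
      qed simp
    qed
  qed
qed

section \<open>From the structure of \<open>F\<close> and the norms of \<open>u\<close> to the
  estimate\<close>

text \<open>The segment from \<open>M\<close> to \<open>N\<close> stays in the superlevel set of
  \<open>F\<close> at height \<open>F M\<close>, so \<open>F\<close> cannot decrease initially along
  it. For two Hessians of a solution both heights are 0, which gives the half-space condition in
  both directions.\<close>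

lemma quasiconcave_tangent:
  fixes F :: "real^'n^'n \<Rightarrow> real"
  assumes F: "(F has_derivative F') (at M within sym_mats)" and q: "quasiconcave_sym F"
    and M: "M \<in> sym_mats" and N: "N \<in> sym_mats" and le: "F M \<le> F N"
  shows "0 \<le> F' (N - M)"
proof (rule ccontr)
  assume neg: "\<not> ?thesis"
  define \<phi> where "\<phi> = (\<lambda>t. F (M + t *\<^sub>R (N - M)))"
  have in_sym: "M + t *\<^sub>R (N - M) \<in> sym_mats" for t
    by (intro subspace_add subspace_scale subspace_diff subspace_sym_mats M N)
  have "((\<lambda>t. M + t *\<^sub>R (N - M)) has_derivative (\<lambda>t. t *\<^sub>R (N - M))) (at 0)"
    by (auto intro!: derivative_eq_intros)
  moreover have "(F has_derivative F') (at (M + 0 *\<^sub>R (N - M)) within range (\<lambda>t. M + t *\<^sub>R (N - M)))"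
    using has_derivative_subset[OF F image_subsetI[OF in_sym]] by simp
  ultimately have "((F \<circ> (\<lambda>t. M + t *\<^sub>R (N - M))) has_derivative (F' \<circ> (\<lambda>t. t *\<^sub>R (N - M)))) (at 0)"
    by (rule diff_chain_within)
  moreover have "linear F'" using F has_derivative_linear by blast
  ultimately have "(\<phi> has_real_derivative F' (N - M)) (at 0)"
    by (simp add: has_field_derivative_def \<phi>_def o_def linear_scale mult.commute[of _ "F' (N - M)"])
  then obtain d where d: "d > 0" "\<And>h. 0 < h \<Longrightarrow> h < d \<Longrightarrow> \<phi> (0 + h) < \<phi> 0"
    using DERIV_neg_dec_right[of \<phi> "F' (N - M)" 0] neg by (auto simp: not_le)
  define h where "h = min (d / 2) 1"
  have h: "0 < h" "h < d" "h \<le> 1" using d(1) by (auto simp: h_def)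
  have "min (F N) (F M) \<le> F (h *\<^sub>R N + (1 - h) *\<^sub>R M)"
    using q M N h unfolding quasiconcave_sym_def by force
  moreover have "h *\<^sub>R N + (1 - h) *\<^sub>R M = M + h *\<^sub>R (N - M)" by (simp add: algebra_simps)
  ultimately show False using d(2)[OF h(1,2)] le by (simp add: \<phi>_def)
qed

text \<open>Serves to read a bound for the Hessian off the Lipschitz seminorm of the gradient, the
  only second-order information in the C^{1,1} norm.\<close>

lemma norm_derivative_le_Lipschitz:
  fixes f :: "'a::real_normed_vector \<Rightarrow> 'b::real_normed_vector"
  assumes f: "(f has_derivative f') (at x)" and "d > 0" and lip: "\<And>y. y \<in> ball x d \<Longrightarrow> norm (f y - f x) \<le> K * norm (y - x)"
  shows "norm (f' h) \<le> K * norm h"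
proof (cases "h = 0")
  case True
  then show ?thesis using linear_0[OF has_derivative_linear[OF f]] by simp
next
  case False
  then have nh: "norm h > 0" by simp
  show ?thesis
  proof (rule field_le_epsilon)
    fix \<epsilon> :: real assume "\<epsilon> > 0"
    then have "\<epsilon> / norm h > 0" using nh by simp
    then obtain b where b: "b > 0" "\<And>y. norm (y - x) < b \<Longrightarrow> norm (f y - f x - f' (y - x)) \<le> \<epsilon> / norm h * norm (y - x)"
      using f unfolding has_derivative_at_alt by blast
    define t where "t = min b d / (2 * norm h)"
    have t: "t > 0" "t * norm h < b" "t * norm h < d" using b(1) \<open>d > 0\<close> nh by (auto simp: t_def)
    define y where "y = x + t *\<^sub>R h"
    have ny: "norm (y - x) = t * norm h" using t by (simp add: y_def)
    have "norm (f' (y - x)) \<le> norm (f y - f x) + norm (f y - f x - f' (y - x))"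
      using norm_triangle_ineq4[of "f y - f x" "f y - f x - f' (y - x)"] by simp
    also have "\<dots> \<le> K * (t * norm h) + \<epsilon> / norm h * (t * norm h)"
      using b(2)[of y] lip[of y] t ny by (intro add_mono) (auto simp: dist_norm norm_minus_commute)
    also have "norm (f' (y - x)) = t * norm (f' h)"
      using t linear_scale[OF has_derivative_linear[OF f]] by (simp add: y_def)
    finally have "t * norm (f' h) \<le> t * (K * norm h + \<epsilon>)" using nh by (simp add: algebra_simps)
    then show "norm (f' h) \<le> K * norm h + \<epsilon>" using t by simp
  qed
qed

lemma sup_norm_mono: "S \<subseteq> T \<Longrightarrow> sup_norm S g \<le> sup_norm T g"
  unfolding sup_norm_def by (rule SUP_subset_mono) auto

lemma sup_norm_nonneg: "x \<in> S \<Longrightarrow> 0 \<le> sup_norm S g"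
  unfolding sup_norm_def by (rule SUP_upper2[of x]) auto

lemma holder_semi_nonneg: "x \<in> S \<Longrightarrow> y \<in> S \<Longrightarrow> x \<noteq> y \<Longrightarrow> 0 \<le> holder_semi a S g"
  unfolding holder_semi_def by (rule SUP_upper2[of "(x, y)"]) auto

lemma holder_semi_leD:
  assumes "holder_semi a S g \<le> ereal K" "x \<in> S" "y \<in> S"
  shows "dist (g x) (g y) \<le> K * dist x y powr a"
proof (cases "x = y")
  case False
  have "ereal (dist (g x) (g y) / dist x y powr a) \<le> holder_semi a S g"
    unfolding holder_semi_def by (rule SUP_upper2[of "(x, y)"]) (use assms False in auto)
  then have "dist (g x) (g y) / dist x y powr a \<le> K" using assms(1) order_trans by fastforce
  then show ?thesis using False by (simp add: pos_divide_le_eq)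
qed simp

theorem theorem3p1:
  fixes lam Lam :: real
  assumes "0 < lam" and "lam \<le> Lam"
  shows "\<exists>\<alpha>::real. 0 < \<alpha> \<and> \<alpha> < 1 \<and>
    (\<forall>K::real. \<exists>C::real. \<forall>(F :: real^'n^'n \<Rightarrow> real)
        (DF :: real^'n^'n \<Rightarrow> ((real^'n^'n) \<Rightarrow>\<^sub>L real))
        (D2F :: real^'n^'n \<Rightarrow> ((real^'n^'n) \<Rightarrow>\<^sub>L ((real^'n^'n) \<Rightarrow>\<^sub>L real)))
        (u :: real^'n \<Rightarrow> real) (Du :: real^'n \<Rightarrow> real^'n) (H :: real^'n \<Rightarrow> real^'n^'n).
      (\<forall>M\<in>sym_mats. (F has_derivative blinfun_apply (DF M)) (at M within sym_mats)) \<and>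
      (\<forall>M\<in>sym_mats. (DF has_derivative blinfun_apply (D2F M)) (at M within sym_mats)) \<and>
      continuous_on sym_mats D2F \<and>
      quasiconcave_sym F \<and>
      F 0 = 0 \<and>
      (\<forall>M\<in>sym_mats. \<forall>\<xi>::real^'n.
         lam * (norm \<xi>)\<^sup>2 \<le> blinfun_apply (DF M) (outer \<xi> \<xi>) \<and> blinfun_apply (DF M) (outer \<xi> \<xi>) \<le> Lam * (norm \<xi>)\<^sup>2) \<and>
      (\<forall>x\<in>ball 0 1. (u has_derivative (\<lambda>h. Du x \<bullet> h)) (at x)) \<and>
      (\<forall>x\<in>ball 0 1. (Du has_derivative (\<lambda>h. H x *v h)) (at x)) \<and>
      continuous_on (ball 0 1) H \<and>
      (\<forall>x\<in>ball 0 1. F (H x) = 0) \<and>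
      C11_norm (cball 0 (3/4)) u Du \<le> ereal K
      \<longrightarrow> C2alpha_norm \<alpha> (cball 0 (1/2)) u Du H \<le> ereal C)"
proof (rule Hessian_Holder_at_center[OF assms, where 'n='n])
  fix \<alpha> C :: real
  assume \<alpha>: "0 < \<alpha>" "\<alpha> < 1" and C: "0 \<le> C"
    and holder: "\<And>(u :: real^'n \<Rightarrow> real) Du H x0 R K y. 0 < R \<Longrightarrow> C2_on (ball x0 R) u Du H \<Longrightarrow>
      (\<And>x. x \<in> ball x0 R \<Longrightarrow> \<exists>L. elliptic lam Lam L \<and> (\<forall>y\<in>ball x0 R. 0 \<le> L (H y - H x))) \<Longrightarrow>
      (\<And>x. x \<in> ball x0 R \<Longrightarrow> norm (H x) \<le> K) \<Longrightarrow> y \<in> ball x0 R \<Longrightarrow>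
      norm (H y - H x0) \<le> C * K * (dist y x0 / R) powr \<alpha>"
  define b where "b = (real CARD('n))\<^sup>2"
  \<comment> \<open>The summands bound \<open>u\<close>, \<open>Du\<close>, \<open>H\<close> and the
    Hoelder seminorm. In \<open>4 * C + 8\<close> the 4 comes from the radius 1/4 of the balls used,
    and 8 is 4 times 2: points at least 1/4 apart satisfy only
    \<open>norm (H x - H y) \<le> 2 * B\<close>, but then
    \<open>4 * dist x y \<ge> 1\<close>.\<close>
  have main: "C2alpha_norm \<alpha> (cball 0 (1/2)) u Du H \<le> ereal (K + K + b * K + (4 * C + 8) * (b * K))"
    if F: "\<forall>M\<in>sym_mats. (F has_derivative blinfun_apply (DF M)) (at M within sym_mats)"
      and q: "quasiconcave_sym F"
      and ellF: "\<forall>M\<in>sym_mats. \<forall>\<xi>::real^'n.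
       lam * (norm \<xi>)\<^sup>2 \<le> blinfun_apply (DF M) (outer \<xi> \<xi>) \<and> blinfun_apply (DF M) (outer \<xi> \<xi>) \<le> Lam * (norm \<xi>)\<^sup>2"
      and u1: "\<forall>x\<in>ball 0 1. (u has_derivative (\<lambda>h. Du x \<bullet> h)) (at x)"
      and u2: "\<forall>x\<in>ball 0 1. (Du has_derivative (\<lambda>h. H x *v h)) (at x)"
      and u3: "continuous_on (ball 0 1) H"
      and eq: "\<forall>x\<in>ball 0 1. F (H x) = 0"
      and K: "C11_norm (cball 0 (3/4)) u Du \<le> ereal K"
    for F :: "real^'n^'n \<Rightarrow> real" and DF u Du H K
  proof -
    define B where "B = b * K"
    have u: "C2_on (ball 0 1) u Du H" using u1 u2 u3 by (simp add: C2_on_def)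
    have sym: "H x \<in> sym_mats" if "x \<in> ball 0 1" for x
      using C2_on_Hessian_sym[OF u open_ball that] by (simp add: sym_mats_def)
    have tangent: "\<exists>L. elliptic lam Lam L \<and> (\<forall>y\<in>ball 0 1. 0 \<le> L (H y - H x))" if x: "x \<in> ball 0 1" for x
    proof (intro exI[of _ "blinfun_apply (DF (H x))"] conjI ballI)
      show "elliptic lam Lam (blinfun_apply (DF (H x)))"
        using ellF sym[OF x] unfolding elliptic_def
        by (auto intro: bounded_linear.linear blinfun.bounded_linear_right)
      show "0 \<le> blinfun_apply (DF (H x)) (H y - H x)" if "y \<in> ball 0 1" for y
        by (rule quasiconcave_tangent[OF _ q]) (use F sym eq x that in auto)
    qed
    let ?S = "cball (0::real^'n) (3/4)"
    have zero: "0 \<in> ?S" by simp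
    \<comment> \<open>Two distinct points make the seminorm a supremum over a nonempty set. In
      \<open>ereal\<close> an empty supremum is minus infinity, and nonnegativity of every summand
      is needed to bound each one by \<open>K\<close>.\<close>
    have half: "(1/2) *\<^sub>R axis undefined 1 \<in> ?S" "(1/2) *\<^sub>R axis undefined 1 \<noteq> (0::real^'n)"
      by (simp_all add: axis_eq_0_iff)
    have nn: "0 \<le> sup_norm ?S u" "0 \<le> sup_norm ?S Du" "0 \<le> holder_semi 1 ?S Du"
      using sup_norm_nonneg[OF zero] holder_semi_nonneg[OF half(1) zero half(2)] by blast+
    have parts: "sup_norm ?S u \<le> ereal K" "sup_norm ?S Du \<le> ereal K" "holder_semi 1 ?S Du \<le> ereal K"
      using order_trans[OF _ K[unfolded C11_norm_def], of "sup_norm ?S u"]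
        order_trans[OF _ K[unfolded C11_norm_def], of "sup_norm ?S Du"]
        order_trans[OF _ K[unfolded C11_norm_def], of "holder_semi 1 ?S Du"]
        add_mono[OF add_mono[OF order_refl nn(2)] nn(3), of "sup_norm ?S u"]
        add_mono[OF add_mono[OF nn(1) order_refl] nn(3), of "sup_norm ?S Du"]
        add_mono[OF add_nonneg_nonneg[OF nn(1,2)] order_refl, of "holder_semi 1 ?S Du"]
      by simp_all
    have K0: "0 \<le> K" using order_trans[OF nn(1) parts(1)] by simp
    then have B0: "0 \<le> B" by (simp add: B_def b_def)
    have HB: "norm (H x) \<le> B" if x: "x \<in> ball 0 (3/4)" for x
    proof -
      obtain d where d: "d > 0" "ball x d \<subseteq> ball 0 (3/4)" 
        using openE[OF open_ball x] by blast
      have "norm (Du y - Du x) \<le> K * norm (y - x)" if "y \<in> ball x d" for y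
      proof -
        have "y \<in> ?S" "x \<in> ?S" using that d x by auto
        from holder_semi_leD[OF parts(3) this] show ?thesis by (simp add: dist_norm)
      qed
      moreover have "x \<in> ball 0 1" using x by auto
      ultimately have "norm (H x *v h) \<le> K * norm h" for h
        using norm_derivative_le_Lipschitz[OF bspec[OF u2] d(1)] by blast
      note le = this
      have "\<bar>H x $ i $ j\<bar> \<le> K" for i j
        using component_le_norm_cart[of "H x *v axis j 1" i] le[of "axis j 1"]
        by (simp add: matrix_vector_mul_component inner_axis)
      from norm_matrix_le[OF this] show ?thesis by (simp add: B_def b_def)
    qed
    let ?T = "cball (0::real^'n) (1/2)"
    have TS: "?T \<subseteq> ?S" by auto
    have "holder_semi \<alpha> ?T H \<le> ereal ((4 * C + 8) * B)"
      unfolding holder_semi_def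
    proof (rule SUP_least, clarify)
      fix x y :: "real^'n" assume xy: "x \<in> ?T" "y \<in> ?T" "x \<noteq> y"
      have sub: "ball y (1/4) \<subseteq> ball 0 (3/4)" "ball y (1/4) \<subseteq> ball 0 1"
        using xy(2) by (auto simp: ball_subset_ball_iff dist_commute)
      have p4: "(4 * dist x y) powr \<alpha> \<le> 4 * dist x y powr \<alpha>"
      proof -
        have "(4 * dist x y) powr \<alpha> = 4 powr \<alpha> * dist x y powr \<alpha>" by (simp add: powr_mult)
        also have "\<dots> \<le> 4 powr 1 * dist x y powr \<alpha>" using \<alpha> by (intro mult_right_mono powr_mono) auto
        finally show ?thesis by simp
      qed
      have "norm (H x - H y) \<le> (C + 2) * B * (4 * dist x y) powr \<alpha>"
      proof (cases "x \<in> ball y (1/4)")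
        case True
        have "norm (H x - H y) \<le> C * B * (dist x y / (1/4)) powr \<alpha>"
        proof (rule holder[OF _ C2_on_subset[OF u sub(2)]])
          show "\<exists>L. elliptic lam Lam L \<and> (\<forall>z\<in>ball y (1/4). 0 \<le> L (H z - H x))" if "x \<in> ball y (1/4)" for x
            using tangent[of x] that sub(2) by blast
        qed (use True HB sub(1) in auto)
        also have "\<dots> \<le> (C + 2) * B * (4 * dist x y) powr \<alpha>"
          using B0 by (simp add: mult.commute[of "dist x y"]) (intro mult_right_mono, auto)
        finally show ?thesis .
      next
        case False
        have "norm (H x - H y) \<le> 2 * B"
          using norm_triangle_ineq4[of "H x" "H y"] HB[of x] HB[of y] xy by auto
        also have "\<dots> \<le> 2 * B * (4 * dist x y) powr \<alpha>"
        proof -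
          have "1 powr \<alpha> \<le> (4 * dist x y) powr \<alpha>" using False \<alpha> by (intro powr_mono2) (auto simp: dist_commute)
          then show ?thesis using B0 mult_left_mono[of 1 "(4 * dist x y) powr \<alpha>" "2 * B"] by simp
        qed
        also have "\<dots> \<le> (C + 2) * B * (4 * dist x y) powr \<alpha>" using B0 C by (intro mult_right_mono) auto
        finally show ?thesis .
      qed
      also have "\<dots> \<le> (C + 2) * B * (4 * dist x y powr \<alpha>)" using p4 B0 C by (intro mult_left_mono) auto
      finally have "dist (H x) (H y) / dist x y powr \<alpha> \<le> (4 * C + 8) * B"
        using xy(3) by (simp add: dist_norm pos_divide_le_eq algebra_simps)
      then show "ereal (dist (H (fst (x, y))) (H (snd (x, y))) / dist (fst (x, y)) (snd (x, y)) powr \<alpha>) \<le> ereal ((4 * C + 8) * B)"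
        by simp
    qed
    moreover have "sup_norm ?T u \<le> ereal K" "sup_norm ?T Du \<le> ereal K"
      by (rule order_trans[OF sup_norm_mono[OF TS]], rule parts)+
    moreover have "sup_norm ?T H \<le> ereal B"
      unfolding sup_norm_def by (rule SUP_least) (use HB in auto)
    ultimately show "C2alpha_norm \<alpha> (cball 0 (1/2)) u Du H \<le> ereal (K + K + b * K + (4 * C + 8) * (b * K))"
      unfolding C2alpha_norm_def B_def plus_ereal.simps(1)[symmetric] by (intro add_mono)
  qed
  show ?thesis
    \<comment> \<open>The second \<open>rule exI\<close> leaves the constant schematic before
      \<open>F\<close> and \<open>u\<close> are introduced; \<open>main\<close> fixes it as an
      expression in \<open>K\<close>, \<open>C\<close> and \<open>b\<close>.\<close>
    by (rule exI[of _ \<alpha>], intro conjI \<alpha>, intro allI, rule exI, intro allI impI, elim conjE, rule main)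
qed

end
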